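(* Let $\Phi(\mathbf{x})=\sum_{i=1}^n\phi_i(x_i)$ be a separable Bregman generator (each $\phi_i:\mathcal{X}\to\mathbb{R}$ a Bregman generator), let $g(\mathbf{x})=\sum_{i=1}^n g_i(x_i)$ be a separable aggregation function, and let $\rho$ be a law-invariant risk functional. Then the following hold for all $\epsilon\ge0$: (i) If $\rho$ is subadditive, then $$\sup_{\mathbf{Z}\in\mathfrak{B}^n_{\Phi,\epsilon}(\mathbf{X})}\rho(g(\mathbf{Z}))\le\sum_{i=1}^n\ \sup_{Z_i\in\mathfrak{B}_{\phi_i,\epsilon}(X_i)}\rho\big(g_i(Z_i)\big).$$ (ii) If $\mathbf{X}$ is comonotonic, $\rho$ is comonotonic additive, and $g_i$ is non-decreasing for all $i\in\{1,\dots,n\}$, then $$\sum_{i=1}^n\ \sup_{Z_i\in\mathfrak{B}_{\phi_i,\epsilon/n}(X_i)}\rho\big(g_i(Z_i)\big)\le\sup_{\mathbf{Z}\in\mathfrak{B}^n_{\Phi,\epsilon}(\mathbf{X})}\rho(g(\mathbf{Z})).$$ (iii) If $\mathbf{X}$ is comonotonic, $g(\mathbf{x})=\boldsymbol\beta^T\mathbf{x}$ for some $\boldsymbol\beta\in\mathbb{R}^n$ with non-negative components, and $\rho$ is positive homogeneous, subadditive, and comonotonic additive, then $$\sum_{i=1}^n\beta_i\sup_{Z_i\in\mathfrak{B}_{\phi_i,\epsilon/n}(X_i)}\rho(Z_i)\le\sup_{\mathbf{Z}\in\mathfrak{B}^n_{\Phi,\epsilon}(\mathbf{X})}\rho(\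boldsymbol\beta^T\mathbf{Z})\le\sum_{i=1}^n\beta_i\sup_{Z_i\in\mathfrak{B}_{\phi_i,\epsilon}(X_i)}\rho(Z_i).$$
   Context: All random variables/vectors live on a fixed non-atomic probability space $(\Omega,\mathcal{B},\mathbb{P})$ with $\mathcal{B}=\mathcal{B}(\mathbb{R}^n)$. $\mathbf{X}=(X_1,\dots,X_n)$ is a given (reference) random vector. A Bregman generator is a convex (not necessarily strictly) and differentiable function $\Phi:\mathcal{X}^n\to\mathbb{R}$ on a convex domain $\mathcal{X}^n\subseteq\mathbb{R}^n$; its Bregman divergence is $B_\Phi(\mathbf{z}_1,\mathbf{z}_2)=\Phi(\mathbf{z}_1)-\Phi(\mathbf{z}_2)-\nabla\Phi(\mathbf{z}_2)\cdot(\mathbf{z}_1-\mathbf{z}_2)$. Random vectors take values in the domain of $\Phi$. The Bregman-Wasserstein (BW) divergence from cdf $F$ to cdf $G$ is $\mathcal{B}^n_\Phi[F,G]=\inf\mathbb{E}[B_\Phi(\mathbf{X},\mathbf{Y})]$, over all couplings with $F_{\mathbf{X}}=F$, $F_{\mathbf{Y}}=G$. The BW uncertainty set is $\mathfrak{B}^n_{\Phi,\epsilon}(\mathbf{X})=\{\mathbf{Z}:\mathcal{B}^n_\Phi[F_{\mathbf{Z}},F_{\mathbf{X}}]\le\epsilon\}$ (superscript dropped when $n=1$); it is tacitly assumed that such sets contain at least two elements. A risk functional $\rho$ is a real-valued functional on random variables (on $\mathcal{L}^p$, the random variables with finite $p$-th absolute moment for a suitable fixed $p\ge1$, with the quantities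 involved assumed well defined). It is law invariant if $\rho(X)=\rho(Y)$ whenever $X,Y$ have the same distribution; subadditive if $\rho(X+Y)\le\rho(X)+\rho(Y)$; comonotonic additive if $\rho(X+Y)=\rho(X)+\rho(Y)$ for all comonotonic $X,Y$; positive homogeneous if $\rho(\theta Y)=\theta\rho(Y)$ for all $\theta\ge0$. Two random variables $X,Y$ are comonotonic if there is $\Omega_0\subseteq\Omega$ with $\mathbb{P}(\Omega_0)=1$ such that $(X(\omega)-X(\omega'))(Y(\omega)-Y(\omega'))\ge0$ for all $\omega,\omega'\in\Omega_0$; a random vector is comonotonic if every two of its components are comonotonic. Standing assumption: $g$ is non-constant. *)

theory Defs
  imports "HOL-Probability.Probability"
begin

section \<open>Random vectors and their distribution functions\<close>

definition nonatomic :: "'w measure \<Rightarrow> bool" where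
  "nonatomic M \<longleftrightarrow>
     (\<forall>A\<in>sets M. 0 < emeasure M A \<longrightarrow>
        (\<exists>B\<in>sets M. B \<subseteq> A \<and> 0 < emeasure M B \<and> emeasure M B < emeasure M A))"

text \<open>
  Everything below that concerns a random vector is stated over an arbitrary
  \<open>ordered_euclidean_space\<close>, whose order is the componentwise one. The type \<open>real ^ 'n\<close>
  gives the \<open>n\<close>-dimensional notions, the type \<open>real\<close> the case \<open>n = 1\<close>.
\<close>

definition random_vectors :: "'w measure \<Rightarrow> 'a::euclidean_space set \<Rightarrow> ('w \<Rightarrow> 'a) set" where
  "random_vectors M S = M \<rightarrow>\<^sub>M restrict_space borel S"

definition joint_cdf ::
  "'w measure \<Rightarrow> ('w \<Rightarrow> 'a::ordered_euclidean_space) \<Rightarrow> 'a \<Rightarrow> real" where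
  "joint_cdf M Z x = measure M {\<omega> \<in> space M. Z \<omega> \<le> x}"

definition comonotonic :: "'w measure \<Rightarrow> ('w \<Rightarrow> real) \<Rightarrow> ('w \<Rightarrow> real) \<Rightarrow> bool" where
  "comonotonic M X Y \<longleftrightarrow>
     (\<exists>A\<in>sets M. measure M A = 1 \<and>
        (\<forall>\<omega>\<in>A. \<forall>\<omega>'\<in>A. 0 \<le> (X \<omega> - X \<omega>') * (Y \<omega> - Y \<omega>')))"

definition comonotonic_vector :: "'w measure \<Rightarrow> ('w \<Rightarrow> real ^ 'n) \<Rightarrow> bool" where
  "comonotonic_vector M X \<longleftrightarrow> (\<forall>i j. comonotonic M (\<lambda>\<omega>. X \<omega> $ i) (\<lambda>\<omega>. X \<omega> $ j))"


section \<open>Bregman-Wasserstein divergence and uncertainty sets\<close>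

definition cart_power :: "real set \<Rightarrow> (real ^ 'n) set" where
  "cart_power D = {x. \<forall>i. x $ i \<in> D}"

text \<open>
  The domain \<open>S\<close> need not be open; differentiability is taken within \<open>S\<close>, which is the usual
  notion at interior points. Convexity of \<open>S\<close> is part of \<open>convex_on\<close>.
\<close>

definition bregman_generator :: "'a::euclidean_space set \<Rightarrow> ('a \<Rightarrow> real) \<Rightarrow> bool" where
  "bregman_generator S \<Phi> \<longleftrightarrow> convex_on S \<Phi> \<and> \<Phi> differentiable_on S"

text \<open>
  If \<open>S\<close> is convex with empty interior, the gradient is only determined up to vectors
  orthogonal to \<open>S - S\<close>. This choice does not affect the divergence, in which the gradient
  is only paired with differences of points of \<open>S\<close>.
\<close>

definition gradient :: "'a::euclidean_space set \<Rightarrow> ('a \<Rightarrow> real) \<Rightarrow> 'a \<Rightarrow> 'a" where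
  "gradient S \<Phi> x = (SOME v. (\<Phi> has_derivative (\<lambda>h. v \<bullet> h)) (at x within S))"

definition bregman_divergence ::
  "'a::euclidean_space set \<Rightarrow> ('a \<Rightarrow> real) \<Rightarrow> 'a \<Rightarrow> 'a \<Rightarrow> real" where
  "bregman_divergence S \<Phi> z1 z2 = \<Phi> z1 - \<Phi> z2 - gradient S \<Phi> z2 \<bullet> (z1 - z2)"

text \<open>
  The Bregman divergence of a convex function is nonnegative, so that its expectation always
  exists in \<open>[0, \<infinity>]\<close> and the conversion to \<open>ennreal\<close> does not truncate anything.
\<close>

definition bw_divergence ::
  "'w measure \<Rightarrow> 'a::ordered_euclidean_space set \<Rightarrow> ('a \<Rightarrow> real)
     \<Rightarrow> ('a \<Rightarrow> real) \<Rightarrow> ('a \<Rightarrow> real) \<Rightarrow> ennreal" where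
  "bw_divergence M S \<Phi> F G =
     (INF (X, Y) \<in> {(X, Y). X \<in> random_vectors M S \<and> Y \<in> random_vectors M S \<and>
                           joint_cdf M X = F \<and> joint_cdf M Y = G}.
        \<integral>\<^sup>+ \<omega>. ennreal (bregman_divergence S \<Phi> (X \<omega>) (Y \<omega>)) \<partial>M)"

definition bw_set ::
  "'w measure \<Rightarrow> 'a::ordered_euclidean_space set \<Rightarrow> ('a \<Rightarrow> real) \<Rightarrow> real
     \<Rightarrow> ('w \<Rightarrow> 'a) \<Rightarrow> ('w \<Rightarrow> 'a) set" where
  "bw_set M S \<Phi> \<epsilon> X =
     {Z \<in> random_vectors M S.
        bw_divergence M S \<Phi> (joint_cdf M Z) (joint_cdf M X) \<le> ennreal \<epsilon>}"

text \<open>Functions that differ only outside \<open>space M\<close> are the same random vector.\<close>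

definition at_least_two :: "'w measure \<Rightarrow> ('w \<Rightarrow> 'a) set \<Rightarrow> bool" where
  "at_least_two M U \<longleftrightarrow> (\<exists>Y\<in>U. \<exists>Z\<in>U. \<exists>\<omega>\<in>space M. Y \<omega> \<noteq> Z \<omega>)"


section \<open>Risk functionals\<close>

text \<open>
  A risk functional is a function \<open>\<rho> :: ('w \<Rightarrow> real) \<Rightarrow> real\<close> of which only the values on
  \<open>Lp M p\<close> matter.
\<close>

definition Lp :: "'w measure \<Rightarrow> real \<Rightarrow> ('w \<Rightarrow> real) set" where
  "Lp M p = {Y \<in> borel_measurable M. integrable M (\<lambda>\<omega>. \<bar>Y \<omega>\<bar> powr p)}"

definition law_invariant :: "'w measure \<Rightarrow> real \<Rightarrow> (('w \<Rightarrow> real) \<Rightarrow> real) \<Rightarrow> bool" where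
  "law_invariant M p \<rho> \<longleftrightarrow>
     (\<forall>X\<in>Lp M p. \<forall>Y\<in>Lp M p. distr M borel X = distr M borel Y \<longrightarrow> \<rho> X = \<rho> Y)"

definition subadditive_risk :: "'w measure \<Rightarrow> real \<Rightarrow> (('w \<Rightarrow> real) \<Rightarrow> real) \<Rightarrow> bool" where
  "subadditive_risk M p \<rho> \<longleftrightarrow>
     (\<forall>X\<in>Lp M p. \<forall>Y\<in>Lp M p. \<rho> (\<lambda>\<omega>. X \<omega> + Y \<omega>) \<le> \<rho> X + \<rho> Y)"

definition comonotonic_additive :: "'w measure \<Rightarrow> real \<Rightarrow> (('w \<Rightarrow> real) \<Rightarrow> real) \<Rightarrow> bool" where
  "comonotonic_additive M p \<rho> \<longleftrightarrow>
     (\<forall>X\<in>Lp M p. \<forall>Y\<in>Lp M p. comonotonic M X Y \<longrightarrow> \<rho> (\<lambda>\<omega>. X \<omega> + Y \<omega>) = \<rho> X + \<rho> Y)"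

definition positive_homogeneous :: "'w measure \<Rightarrow> real \<Rightarrow> (('w \<Rightarrow> real) \<Rightarrow> real) \<Rightarrow> bool" where
  "positive_homogeneous M p \<rho> \<longleftrightarrow>
     (\<forall>Y\<in>Lp M p. \<forall>\<theta>\<ge>0. \<rho> (\<lambda>\<omega>. \<theta> * Y \<omega>) = \<theta> * \<rho> Y)"

end

theory Submission
  imports Defs
begin

text \<open>
  The gradient of a separable generator acts coordinatewise, so the divergence of \<open>\<Phi>\<close> is the sum
  of the nonnegative divergences of the \<open>\<phi>\<^sub>i\<close>. Hence the components of an element of the
  \<open>n\<close>-dimensional uncertainty set lie in the one-dimensional sets of the same radius, and
  subadditivity gives (i).

  For (ii), nonatomicity provides a uniform random variable \<open>U\<close>; given \<open>Z\<^sub>i\<close> in the sets of radius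
  \<open>\<epsilon> / n\<close>, couple the quantile transforms of all \<open>Z\<^sub>i\<close> and all \<open>X\<^sub>i\<close> through \<open>U\<close>. A comonotonic
  vector is determined in law by its marginals, so the second vector is distributed like \<open>X\<close>. The
  coupling is optimal in each coordinate because
  \<open>B\<^sub>\<phi>(z, x) = \<integral>\<integral> (1{\<phi>'(x) < s < \<phi>'(t), t \<le> z} + 1{\<phi>'(t) < s < \<phi>'(x), z \<le> t}) ds dt\<close>
  expresses the cost through probabilities of an up-set for one variable and a down-set for the other,
  and comonotonicity minimises each of these. So the divergences add up to at most \<open>\<epsilon>\<close>. Part (iii)
  applies both arguments to \<open>x \<mapsto> \<beta>\<^sub>i x\<close>.
\<close>

section \<open>Uniform random variables on nonatomic spaces\<close>

text \<open>Only the digits 0 and 1 occur in base 3. At the first differing index n the two series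
  differ by 3^-n, while all later digits together contribute at most half of that. Base 2 would
  fail, since 0111... and 1000... have the same value.\<close>

lemma ternary_digits_unique:
  fixes a b :: "nat \<Rightarrow> bool"
  assumes eq: "(\<Sum>n. of_bool (a n) / 3 ^ n :: real) = (\<Sum>n. of_bool (b n) / 3 ^ n)"
  shows "a = b"
proof (rule ccontr)
  assume "a \<noteq> b"
  then obtain m where m: "a m \<noteq> b m" by auto
  define n where "n = (LEAST n. a n \<noteq> b n)"
  have n: "a n \<noteq> b n" unfolding n_def by (rule LeastI, rule m)
  have least: "a k = b k" if "k < n" for k
    using not_less_Least[of k "\<lambda>n. a n \<noteq> b n"] that unfolding n_def by auto
  define c where "c k = (of_bool (a k) - of_bool (b k) :: real) / 3 ^ k" for k
  have geo: "summable (\<lambda>k. (1 / 3 :: real) ^ k)" by (rule summable_geometric) simp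
  have summ: "summable (\<lambda>k. of_bool (d k) / 3 ^ k :: real)" for d :: "nat \<Rightarrow> bool"
    by (rule summable_comparison_test[OF _ geo]) (auto simp: power_one_over field_simps)
  have c_eq: "c = (\<lambda>k. of_bool (a k) / 3 ^ k - of_bool (b k) / 3 ^ k)"
    by (simp add: c_def diff_divide_distrib fun_eq_iff)
  have sc: "summable c" unfolding c_eq by (intro summable_diff summ)
  have "suminf c = 0" unfolding c_eq using suminf_diff[OF summ[of a] summ[of b]] eq by simp
  moreover have "suminf c = (\<Sum>k. c (k + Suc n)) + sum c {..<Suc n}"
    by (rule suminf_split_initial_segment[OF sc])
  moreover have "sum c {..<Suc n} = c n"
    using least by (simp add: c_def)
  ultimately have "\<bar>c n\<bar> = \<bar>\<Sum>k. c (k + Suc n)\<bar>" by linarith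
  also have "\<dots> \<le> (\<Sum>k. (1 / 3) ^ Suc n * (1 / 3 :: real) ^ k)"
    unfolding real_norm_def[symmetric]
    by (intro norm_suminf_le summable_mult geo) (auto simp: c_def power_one_over power_add mult_ac)
  also have "\<dots> = (1/3) ^ Suc n * (3/2)"
    by (subst suminf_mult[OF geo]) (simp add: suminf_geometric)
  finally have "\<bar>c n\<bar> \<le> (1/3) ^ Suc n * (3/2)" .
  moreover have "\<bar>c n\<bar> = (1/3) ^ n"
    using n by (auto simp: c_def power_one_over)
  ultimately show False by simp
qed

text \<open>Words grow at the head, so \<open>b # l\<close> names one of the two pieces of the cell
  of \<open>l\<close>. If \<open>h\<close> always picks a subset, the words of length n index a
  partition of \<open>S\<close>.\<close>

primrec bisection_cell :: "('w set \<Rightarrow> 'w set) \<Rightarrow> 'w set \<Rightarrow> bool list \<Rightarrow> 'w set" where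
  "bisection_cell h S [] = S"
| "bisection_cell h S (b # l) =
     (if b then h (bisection_cell h S l) else bisection_cell h S l - h (bisection_cell h S l))"

lemma bisection_cell_disjoint:
  assumes "\<And>l. h (bisection_cell h S l) \<subseteq> bisection_cell h S l"
    and "length l = length l'" "\<omega> \<in> bisection_cell h S l" "\<omega> \<in> bisection_cell h S l'"
  shows "l = l'"
  using assms(2-)
proof (induction l l' rule: list_induct2)
  case (Cons b l b' l')
  then show ?case using assms(1)[of l] assms(1)[of l'] by (auto split: if_splits)
qed simp

text \<open>The best balanced splitting of \<open>C\<close> need not exist, but any set above half
  of the supremum will do. If the supremum is 0, every splitting is trivial and the empty set
  serves.\<close>

lemma (in prob_space) near_optimal_bisection:
  assumes "C \<in> events"
  shows "\<exists>B\<in>events. B \<subseteq> C \<and> (\<forall>B'\<in>events. B' \<subseteq> C \<longrightarrow>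
    min (prob B') (prob (C - B')) \<le> 2 * min (prob B) (prob (C - B)))"
proof -
  define S where "S = (\<lambda>B. min (prob B) (prob (C - B))) ` {B \<in> events. B \<subseteq> C}"
  have bdd: "bdd_above S" unfolding S_def by (auto intro!: bdd_aboveI[of _ 1] simp: min_le_iff_disj)
  have le: "min (prob B) (prob (C - B)) \<le> Sup S" if "B \<in> events" "B \<subseteq> C" for B
    by (rule cSup_upper[OF _ bdd]) (use that in \<open>auto simp: S_def\<close>)
  show ?thesis
  proof (cases "Sup S \<le> 0")
    case True
    then show ?thesis by (intro bexI[of _ "{}"]) (auto dest!: le)
  next
    case False
    then have "Sup S / 2 < Sup S" by simp
    moreover have "S \<noteq> {}" by (auto simp: S_def)
    ultimately obtain y where y: "y \<in> S" "Sup S / 2 < y" using less_cSupD by blast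
    then obtain B where B: "B \<in> events" "B \<subseteq> C" "Sup S / 2 < min (prob B) (prob (C - B))"
      unfolding S_def by blast
    have "min (prob B') (prob (C - B')) \<le> 2 * min (prob B) (prob (C - B))"
      if "B' \<in> events" "B' \<subseteq> C" for B'
      using le[OF that] B(3) by linarith
    with B(1,2) show ?thesis by blast
  qed
qed

text \<open>
  Bisect greedily: along a path of cells whose intersection \<open>K\<close> has positive measure, a nontrivial
  splitting of \<open>K\<close> bounds the mass removed at every step from below, which is absurd. So the
  ternary expansion that codes the path has no atoms.
\<close>

lemma (in prob_space) nonatomic_imp_continuous_rv:
  assumes "nonatomic M"
  shows "\<exists>f\<in>borel_measurable M. \<forall>c::real. prob {\<omega> \<in> space M. f \<omega> = c} = 0"
proof -
  from near_optimal_bisection obtain h where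
    h: "\<And>C. C \<in> events \<Longrightarrow> h C \<in> events" "\<And>C. C \<in> events \<Longrightarrow> h C \<subseteq> C"
       "\<And>C B. C \<in> events \<Longrightarrow> B \<in> events \<Longrightarrow> B \<subseteq> C \<Longrightarrow>
          min (prob B) (prob (C - B)) \<le> 2 * min (prob (h C)) (prob (C - h C))"
    by metis
  define cell where "cell = bisection_cell h (space M)"
  have cell_Cons: "cell (b # l) = (if b then h (cell l) else cell l - h (cell l))" for b l
    by (simp add: cell_def)
  have cell_ev: "cell l \<in> events" for l
    by (induction l) (auto simp: cell_def h)
  \<comment> \<open>The indicator of \<open>A n\<close> is the n-th digit of the code: it records
    whether the point enters the piece chosen by \<open>h\<close> at level n.\<close>
  define A where "A n = (\<Union>l\<in>{l. length l = n}. h (cell l))" for n :: nat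
  have A[measurable]: "A n \<in> events" for n
    unfolding A_def by (rule sets.countable_UN') (auto simp: h cell_ev)
  have A_iff: "\<omega> \<in> A (length l) \<longleftrightarrow> \<omega> \<in> h (cell l)" if "\<omega> \<in> cell l" for \<omega> l
  proof
    assume "\<omega> \<in> A (length l)"
    then obtain l' where l': "length l' = length l" "\<omega> \<in> h (cell l')" by (auto simp: A_def)
    with h(2)[OF cell_ev] have "\<omega> \<in> cell l'" by blast
    with that l' have "l' = l"
      using bisection_cell_disjoint[of h "space M" l' l \<omega>] h(2)[OF cell_ev]
      unfolding cell_def by blast
    with l' show "\<omega> \<in> h (cell l)" by simp
  qed (auto simp: A_def)
  define f where "f \<omega> = (\<Sum>n. of_bool (\<omega> \<in> A n) / 3 ^ n :: real)" for \<omega>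
  have f: "f \<in> borel_measurable M" unfolding f_def by measurable
  have "prob {\<omega> \<in> space M. f \<omega> = c} = 0" for c
  proof (cases "{\<omega> \<in> space M. f \<omega> = c} = {}")
    case True
    then show ?thesis by (metis measure_empty)
  next
    case False
    then obtain \<omega>0 where \<omega>0: "\<omega>0 \<in> space M" "f \<omega>0 = c" by auto
    \<comment> \<open>\<open>l n\<close> spells the first n digits of \<open>\<omega>0\<close>.
      Points with the same value of \<open>f\<close> have the same digits, so the whole level set
      follows this path of cells.\<close>
    define l where "l = rec_nat [] (\<lambda>n l. (\<omega>0 \<in> A n) # l)"
    have l_simps: "l 0 = []" "l (Suc n) = (\<omega>0 \<in> A n) # l n" for n by (auto simp: l_def)
    have len: "length (l n) = n" for n by (induction n) (auto simp: l_simps)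
    have sub: "{\<omega> \<in> space M. f \<omega> = c} \<subseteq> cell (l n)" for n
    proof safe
      fix \<omega> assume \<omega>: "\<omega> \<in> space M" "c = f \<omega>"
      then have "(\<lambda>n. \<omega> \<in> A n) = (\<lambda>n. \<omega>0 \<in> A n)"
        using \<omega>0 by (intro ternary_digits_unique) (simp add: f_def)
      then have same: "\<omega> \<in> A n \<longleftrightarrow> \<omega>0 \<in> A n" for n by (rule fun_cong)
      show "\<omega> \<in> cell (l n)"
      proof (induction n)
        case 0
        then show ?case using \<omega> by (simp add: l_simps cell_def)
      next
        case (Suc n)
        then show ?case using A_iff[OF Suc] same[of n] by (auto simp: len l_simps cell_Cons)
      qed
    qed
    define K where "K = (\<Inter>n. cell (l n))"
    have K: "K \<in> events" unfolding K_def by (auto intro: cell_ev)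
    have "prob K = 0"
    proof (rule ccontr)
      assume "prob K \<noteq> 0"
      then have "0 < emeasure M K"
        by (simp add: emeasure_eq_measure zero_less_measure_iff)
      then obtain B where B: "B \<in> events" "B \<subseteq> K" "0 < emeasure M B" "emeasure M B < emeasure M K"
        using assms K unfolding nonatomic_def by blast
      define \<delta> where "\<delta> = min (prob B) (prob (K - B))"
      have "prob (K - B) = prob K - prob B" by (rule finite_measure_Diff) (use B K in auto)
      then have \<delta>: "0 < \<delta>" using B by (auto simp: \<delta>_def emeasure_eq_measure ennreal_less_iff)
      have step: "prob (cell (l (Suc n))) \<le> prob (cell (l n)) - \<delta> / 2" for n
      proof -
        let ?C = "cell (l n)"
        have "K \<subseteq> ?C" by (auto simp: K_def)
        \<comment> \<open>\<open>B\<close> splits each cell on the path at least as evenly as it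
          splits \<open>K\<close>, so near-optimality makes each greedy splitting remove at least
          half of \<open>\<delta>\<close>.\<close>
        then have "prob (K - B) \<le> prob (?C - B)"
          by (intro finite_measure_mono) (use B cell_ev in auto)
        then have "\<delta> \<le> 2 * min (prob (h ?C)) (prob (?C - h ?C))"
          using h(3)[OF cell_ev[of "l n"] B(1)] order_trans[OF B(2) \<open>K \<subseteq> ?C\<close>]
          unfolding \<delta>_def by linarith
        moreover have "prob (?C - h ?C) = prob ?C - prob (h ?C)"
          by (rule finite_measure_Diff) (use h cell_ev in auto)
        ultimately have "prob (h ?C) \<le> prob ?C - \<delta> / 2 \<and> prob (?C - h ?C) \<le> prob ?C - \<delta> / 2"
          by linarith
        then show ?thesis by (auto simp: l_simps cell_Cons)
      qed
      have "prob (cell (l n)) \<le> 1 - real n * (\<delta> / 2)" for n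
      proof (induction n)
        case (Suc n)
        then show ?case using step[of n] by (simp add: algebra_simps add_divide_distrib)
      qed simp
      moreover obtain n where "1 < real n * (\<delta> / 2)"
        using reals_Archimedean3[of "\<delta> / 2"] \<delta> by (metis half_gt_zero)
      ultimately show False using measure_nonneg[of M "cell (l n)"] by (smt (verit))
    qed
    moreover have "prob {\<omega> \<in> space M. f \<omega> = c} \<le> prob K"
      by (rule finite_measure_mono[OF _ K]) (use sub in \<open>auto simp: K_def\<close>)
    ultimately show ?thesis by (simp add: measure_le_0_iff)
  qed
  with f show ?thesis by blast
qed

text \<open>Probability integral transform: a variable without atoms has a continuous cdf
  \<open>F\<close>, and \<open>F\<close> applied to it is uniform. The values 0 and 1 occur with
  probability 0 and are replaced by 1/2, so that quantile functions can be evaluated at every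
  point.\<close>

lemma (in prob_space) nonatomic_imp_uniform_rv:
  assumes "nonatomic M"
  obtains U where "U \<in> borel_measurable M" "\<And>\<omega>. U \<omega> \<in> {0<..<1::real}"
    "\<And>t. 0 \<le> t \<Longrightarrow> t \<le> 1 \<Longrightarrow> prob {\<omega> \<in> space M. U \<omega> \<le> t} = t"
proof -
  obtain f where f[measurable]: "f \<in> borel_measurable M"
    and f0: "\<And>c::real. prob {\<omega> \<in> space M. f \<omega> = c} = 0"
    using nonatomic_imp_continuous_rv[OF assms] by blast
  interpret f: real_distribution "distr M borel f" by (rule real_distribution_distr) simp
  define F where "F = cdf (distr M borel f)"
  have F_eq: "F x = prob {\<omega> \<in> space M. f \<omega> \<le> x}" for x
    unfolding F_def cdf_def by (simp add: measure_distr vimage_def Int_def conj_commute)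
  have F_mono: "x \<le> y \<Longrightarrow> F x \<le> F y" for x y
    unfolding F_def by (rule f.cdf_nondecreasing)
  have [measurable]: "F \<in> borel_measurable borel"
    by (rule borel_measurable_mono) (auto intro: monoI F_mono)
  have F_cont: "isCont F x" for x
    unfolding F_def f.isCont_cdf using f0[of x]
    by (simp add: measure_distr vimage_def Int_def conj_commute)
  have surj: "\<exists>x. F x = t" if t: "0 < t" "t < 1" for t
  proof -
    have "eventually (\<lambda>x. F x < t) at_bot"
      using f.cdf_lim_at_bot t unfolding F_def by (auto dest: order_tendstoD)
    then obtain a where a: "F a < t" by (auto dest: eventually_happens)
    have "eventually (\<lambda>x. t < F x) at_top"
      using f.cdf_lim_at_top_prob t unfolding F_def by (auto dest: order_tendstoD)
    then obtain b where b: "t < F b" by (auto dest: eventually_happens)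
    have "a \<le> b" using F_mono[of b a] a b by force
    then show ?thesis using IVT[of F a t b] a b F_cont by auto
  qed
  have Ft: "prob {\<omega> \<in> space M. F (f \<omega>) \<le> t} = t" if t: "0 < t" "t < 1" for t
  proof (rule antisym)
    show "prob {\<omega> \<in> space M. F (f \<omega>) \<le> t} \<le> t"
    \<comment> \<open>\<open>F\<close> may be flat at level t, so the event can be larger than a
      sublevel set of \<open>f\<close> cut at a point of level t. A point of level t' > t encloses
      it, and t' is then lowered to t.\<close>
    proof (rule dense_ge_bounded[OF t(2)])
      fix t' assume t': "t < t'" "t' < 1"
      then obtain x where x: "F x = t'" using surj t by force
      have "f \<omega> \<le> x" if "F (f \<omega>) \<le> t" for \<omega>
        using F_mono[of x "f \<omega>"] x t' that by force
      then have "prob {\<omega> \<in> space M. F (f \<omega>) \<le> t} \<le> F x"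
        unfolding F_eq by (intro finite_measure_mono) auto
      then show "prob {\<omega> \<in> space M. F (f \<omega>) \<le> t} \<le> t'" using x by simp
    qed
    obtain x where x: "F x = t" using surj t by blast
    have "F x \<le> prob {\<omega> \<in> space M. F (f \<omega>) \<le> t}"
      unfolding F_eq[of x] by (intro finite_measure_mono) (auto simp flip: x intro: F_mono)
    then show "t \<le> prob {\<omega> \<in> space M. F (f \<omega>) \<le> t}" using x by simp
  qed
  have range: "AE \<omega> in M. F (f \<omega>) \<in> {0<..<1}"
  proof -
    let ?E = "{\<omega> \<in> space M. F (f \<omega>) \<in> {0<..<1}}"
    have "1 \<le> prob ?E"
    proof (rule field_le_epsilon)
      fix e :: real assume "0 < e"
      \<comment> \<open>The event \<open>d < F f \<le> 1 - d\<close> has probability 1 - 2d, hence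
        2d must be at most e. The cap at 1 keeps d and 1 - d ordered inside the open unit
        interval.\<close>
      define d where "d = min e 1 / 3"
      have d: "0 < d" "d < 1 - d" "1 - d < 1" "2 * d \<le> e" using \<open>0 < e\<close> by (auto simp: d_def)
      have "1 - d = prob {\<omega> \<in> space M. F (f \<omega>) \<le> 1 - d}" using Ft[of "1 - d"] d by simp
      also have "\<dots> \<le> prob (?E \<union> {\<omega> \<in> space M. F (f \<omega>) \<le> d})"
        by (rule finite_measure_mono) (use d in auto)
      also have "\<dots> \<le> prob ?E + prob {\<omega> \<in> space M. F (f \<omega>) \<le> d}"
        by (rule measure_Un_le) measurable
      finally show "1 \<le> prob ?E + e" using Ft[of d] d by simp
    qed
    then show ?thesis by (subst prob_Collect_eq_1[symmetric]) (auto intro: antisym)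
  qed
  show thesis
  proof
    show "(\<lambda>\<omega>. if F (f \<omega>) \<in> {0<..<1} then F (f \<omega>) else 1 / 2) \<in> borel_measurable M"
      by measurable
    show "prob {\<omega> \<in> space M. (if F (f \<omega>) \<in> {0<..<1} then F (f \<omega>) else 1 / 2) \<le> t} = t"
      (is "prob ?E = t") if t: "0 \<le> t" "t \<le> 1" for t
    proof -
      consider "t = 0" | "t = 1" | "0 < t" "t < 1" using t by linarith
      then show ?thesis
      proof cases
        case 1
        then have "?E = {}" by auto
        then show ?thesis using 1 by (metis measure_empty)
      next
        case 2
        then have "?E = space M" by auto
        then show ?thesis using 2 prob_space by metis
      next
        case 3
        have "prob ?E = prob {\<omega> \<in> space M. F (f \<omega>) \<le> t}"
        proof (rule finite_measure_eq_AE)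
          show "AE \<omega> in M. (\<omega> \<in> ?E) = (\<omega> \<in> {\<omega> \<in> space M. F (f \<omega>) \<le> t})"
            using range by eventually_elim auto
        qed measurable
        then show ?thesis using Ft[OF 3] by simp
      qed
    qed
  qed auto
qed

section \<open>Bregman divergences\<close>

text \<open>A linear functional on a Euclidean space is the inner product with a vector, so the
  choice made in \<open>gradient\<close> has a witness.\<close>

lemma has_derivative_gradient:
  fixes S :: "'a::euclidean_space set"
  assumes "bregman_generator S \<Phi>" "x \<in> S"
  shows "(\<Phi> has_derivative (\<lambda>h. gradient S \<Phi> x \<bullet> h)) (at x within S)"
proof -
  obtain f' where f': "(\<Phi> has_derivative f') (at x within S)"
    using assms by (auto simp: bregman_generator_def differentiable_on_def differentiable_def)
  interpret f': bounded_linear f' by (rule has_derivative_bounded_linear[OF f'])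
  define v where "v = (\<Sum>b\<in>Basis. f' b *\<^sub>R b)"
  have "f' h = v \<bullet> h" for h
  proof -
    have "f' h = f' (\<Sum>b\<in>Basis. (h \<bullet> b) *\<^sub>R b)" by (simp add: euclidean_representation)
    also have "\<dots> = v \<bullet> h"
      by (simp add: v_def f'.sum f'.scaleR inner_sum_left inner_commute[of h] mult.commute)
    finally show ?thesis .
  qed
  then have "f' = (\<lambda>h. v \<bullet> h)" by blast
  with f' have "(\<Phi> has_derivative (\<lambda>h. v \<bullet> h)) (at x within S)" by blast
  then show ?thesis unfolding gradient_def by (rule someI)
qed

text \<open>Restricting to the segment from \<open>x\<close> to \<open>z\<close> reduces statements
  about derivatives within a convex set to one real variable.\<close>

lemma has_derivative_segment:
  fixes f :: "'a::real_normed_vector \<Rightarrow> real"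
  assumes f: "(f has_derivative f') (at x within S)" and S: "convex S" "x \<in> S" "z \<in> S"
  shows "((\<lambda>t. f (x + t *\<^sub>R (z - x))) has_vector_derivative f' (z - x)) (at 0 within {0..1})"
proof -
  have img: "(\<lambda>t. x + t *\<^sub>R (z - x)) ` {0..1} \<subseteq> S"
  proof safe
    fix t :: real assume "t \<in> {0..1}"
    then have "(1 - t) *\<^sub>R x + t *\<^sub>R z \<in> S" using S by (intro convexD) auto
    then show "x + t *\<^sub>R (z - x) \<in> S" by (simp add: algebra_simps)
  qed
  interpret f': bounded_linear f' by (rule has_derivative_bounded_linear[OF f])
  have "((\<lambda>t. x + t *\<^sub>R (z - x)) has_derivative (\<lambda>t. t *\<^sub>R (z - x))) (at 0 within {0..1})"
    by (rule has_derivative_eq_rhs) (rule derivative_intros | simp)+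
  moreover have "(f has_derivative f') (at (x + 0 *\<^sub>R (z - x)) within (\<lambda>t. x + t *\<^sub>R (z - x)) ` {0..1})"
    using has_derivative_subset[OF f img] by simp
  ultimately have "((\<lambda>t. f (x + t *\<^sub>R (z - x))) has_derivative (\<lambda>t. f' (t *\<^sub>R (z - x)))) (at 0 within {0..1})"
    by (rule has_derivative_in_compose)
  then show ?thesis by (simp add: has_vector_derivative_def f'.scaleR)
qed

text \<open>Within a convex set that may have empty interior, derivatives are determined only in
  directions pointing into the set. There they agree, because a derivative on a nondegenerate real
  interval is unique.\<close>

lemma has_derivative_unique_on_convex:
  fixes f :: "'a::real_normed_vector \<Rightarrow> real"
  assumes "(f has_derivative f') (at x within S)" "(f has_derivative f'') (at x within S)"
    and "convex S" "x \<in> S" "z \<in> S"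
  shows "f' (z - x) = f'' (z - x)"
proof (rule vector_derivative_unique_within_closed_interval)
  show "(0::real) < 1" "0 \<in> cbox (0::real) 1" by auto
qed (use assms in \<open>auto intro!: has_derivative_segment\<close>)

text \<open>By convexity the difference quotients along the segment from \<open>x\<close> to
  \<open>z\<close> never exceed \<open>\<Phi> z - \<Phi> x\<close>; their one-sided limit at 0 is
  the gradient term.\<close>

lemma bregman_divergence_nonneg:
  fixes S :: "'a::euclidean_space set"
  assumes gen: "bregman_generator S \<Phi>" and x: "x \<in> S" and z: "z \<in> S"
  shows "0 \<le> bregman_divergence S \<Phi> z x"
proof -
  have S: "convex S" and conv: "convex_on S \<Phi>"
    using gen by (auto simp: bregman_generator_def convex_on_imp_convex)
  let ?h = "\<lambda>t. \<Phi> (x + t *\<^sub>R (z - x))"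
  have "(?h has_vector_derivative gradient S \<Phi> x \<bullet> (z - x)) (at 0 within {0..1})"
    using has_derivative_segment[OF has_derivative_gradient[OF gen x] S x z] by simp
  then have "((\<lambda>t. (?h t - ?h 0) / (t - 0)) \<longlongrightarrow> gradient S \<Phi> x \<bullet> (z - x)) (at 0 within {0..1})"
    by (simp add: has_real_derivative_iff_has_vector_derivative[symmetric] has_field_derivative_iff)
  moreover have "\<forall>\<^sub>F t in at 0 within {0..1}. (?h t - ?h 0) / (t - 0) \<le> \<Phi> z - \<Phi> x"
    unfolding eventually_at
  proof (intro exI[of _ 1] conjI ballI impI)
    fix t :: real assume t: "t \<in> {0..1}" "t \<noteq> 0 \<and> dist t 0 < 1"
    have "?h t = \<Phi> ((1 - t) *\<^sub>R x + t *\<^sub>R z)" by (simp add: algebra_simps)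
    also have "\<dots> \<le> (1 - t) * \<Phi> x + t * \<Phi> z"
      by (rule convex_onD[OF conv]) (use t x z in auto)
    finally show "(?h t - ?h 0) / (t - 0) \<le> \<Phi> z - \<Phi> x" using t by (simp add: field_simps)
  qed simp
  moreover have "at (0::real) within {0..1} \<noteq> bot"
    by (simp add: at_within_Icc_at_right)
  ultimately have "gradient S \<Phi> x \<bullet> (z - x) \<le> \<Phi> z - \<Phi> x"
    by (intro tendsto_upperbound)
  then show ?thesis by (simp add: bregman_divergence_def)
qed

text \<open>The chosen gradient of \<open>\<Phi>\<close> and the tuple of chosen one-dimensional
  gradients need not be the same vector. Both represent a derivative of \<open>\<Phi>\<close> at
  \<open>x\<close> within the domain, so they agree on \<open>z - x\<close>, which is all the
  divergence sees.\<close>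

lemma bregman_divergence_separable:
  fixes \<Phi> :: "real ^ 'n \<Rightarrow> real"
  assumes gen: "bregman_generator (cart_power D) \<Phi>"
    and gens: "\<And>i. bregman_generator D (\<phi> i)"
    and sep: "\<And>x. x \<in> cart_power D \<Longrightarrow> \<Phi> x = (\<Sum>i\<in>UNIV. \<phi> i (x $ i))"
    and x: "x \<in> cart_power D" and z: "z \<in> cart_power D"
  shows "bregman_divergence (cart_power D) \<Phi> z x =
    (\<Sum>i\<in>UNIV. bregman_divergence D (\<phi> i) (z $ i) (x $ i))"
proof -
  let ?S = "cart_power D :: (real ^ 'n) set"
  let ?d = "\<lambda>h. \<Sum>i\<in>UNIV. gradient D (\<phi> i) (x $ i) * h $ i"
  have S: "convex ?S" using gen by (auto simp: bregman_generator_def convex_on_imp_convex)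
  have "((\<lambda>y. \<phi> i (y $ i)) has_derivative (\<lambda>h. gradient D (\<phi> i) (x $ i) * h $ i)) (at x within ?S)"
    for i
  proof -
    have "((\<lambda>y :: real ^ 'n. y $ i) has_derivative (\<lambda>h. h $ i)) (at x within ?S)"
      by (intro bounded_linear_imp_has_derivative bounded_linear_vec_nth)
    moreover have "(\<phi> i has_derivative (\<lambda>h. gradient D (\<phi> i) (x $ i) * h)) (at (x $ i) within (\<lambda>y. y $ i) ` ?S)"
      by (rule has_derivative_subset[OF has_derivative_gradient[OF gens, unfolded inner_real_def]])
         (use x in \<open>auto simp: cart_power_def\<close>)
    ultimately show ?thesis by (rule has_derivative_in_compose)
  qed
  then have "((\<lambda>y. \<Sum>i\<in>UNIV. \<phi> i (y $ i)) has_derivative ?d) (at x within ?S)"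
    by (intro has_derivative_sum)
  then have "(\<Phi> has_derivative ?d) (at x within ?S)"
    by (rule has_derivative_transform[OF x sep, rotated])
  then have "gradient ?S \<Phi> x \<bullet> (z - x) = ?d (z - x)"
    by (rule has_derivative_unique_on_convex[OF has_derivative_gradient[OF gen x] _ S x z])
  then show ?thesis
    by (simp add: bregman_divergence_def sep x z sum_subtractf)
qed

section \<open>Generators on the line: monotone derivative and layer formula\<close>

text \<open>The divergences of (x, y) and (y, x) add up to the product of the increments of the
  gradient and of the argument, and both are nonnegative.\<close>

lemma gradient_mono_on:
  fixes D :: "real set"
  assumes gen: "bregman_generator D \<phi>"
  shows "mono_on D (gradient D \<phi>)"
proof (rule mono_onI)
  fix x y assume xy: "x \<in> D" "y \<in> D" "x \<le> y"
  have "0 \<le> bregman_divergence D \<phi> x y + bregman_divergence D \<phi> y x"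
    using bregman_divergence_nonneg[OF gen] xy by (intro add_nonneg_nonneg) auto
  also have "\<dots> = (gradient D \<phi> y - gradient D \<phi> x) * (y - x)"
    by (simp add: bregman_divergence_def algebra_simps)
  finally show "gradient D \<phi> x \<le> gradient D \<phi> y"
    using xy by (cases "x = y") (auto simp: zero_le_mult_iff)
qed

text \<open>Integrand of the layer formula, with \<open>d\<close> standing for the derivative. For
  fixed t and s each summand is a condition on \<open>x\<close> times a condition on
  \<open>z\<close>, which is what later turns expectations into joint probabilities. That t lies
  beyond \<open>x\<close> is implicit: for monotone \<open>d\<close>, \<open>d x < s < d t\<close>
  forces \<open>x < t\<close>, and symmetrically.\<close>

definition bregman_layer :: "real set \<Rightarrow> (real \<Rightarrow> real) \<Rightarrow> real \<Rightarrow> real \<Rightarrow> real \<Rightarrow> real \<Rightarrow> ennreal" where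
  "bregman_layer D d z x t s =
     (if t \<in> D \<and> d x < s \<and> s < d t \<and> t \<le> z then 1 else 0) +
     (if t \<in> D \<and> d t < s \<and> s < d x \<and> z \<le> t then 1 else 0)"

lemma borel_measurable_gradient:
  fixes D :: "real set"
  assumes "bregman_generator D \<phi>"
  shows "D \<in> sets borel" "gradient D \<phi> \<in> borel_measurable (restrict_space borel D)"
proof -
  have "is_interval D"
    using assms by (auto simp: bregman_generator_def is_interval_convex_1 dest: convex_on_imp_convex)
  then show "D \<in> sets borel" by (rule real_interval_borel_measurable)
  show "gradient D \<phi> \<in> borel_measurable (restrict_space borel D)"
    by (rule borel_measurable_mono_on_fnc[OF gradient_mono_on[OF assms]])
qed

text \<open>In s each summand is the indicator of an open interval; \<open>ennreal\<close> truncates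
  its length to 0 when the endpoints are reversed.\<close>

lemma nn_integral_bregman_layer_inner:
  "(\<integral>\<^sup>+ s. bregman_layer D d z x t s \<partial>lborel) =
     (if t \<in> D \<and> t \<le> z then ennreal (d t - d x) else 0) +
     (if t \<in> D \<and> z \<le> t then ennreal (d x - d t) else 0)"
proof -
  have 1: "(if t \<in> D \<and> d x < s \<and> s < d t \<and> t \<le> z then 1 else 0 :: ennreal) =
      (if t \<in> D \<and> t \<le> z then 1 else 0) * indicator {d x<..<d t} s" for s
    by (auto simp: indicator_def)
  have 2: "(if t \<in> D \<and> d t < s \<and> s < d x \<and> z \<le> t then 1 else 0 :: ennreal) =
      (if t \<in> D \<and> z \<le> t then 1 else 0) * indicator {d t<..<d x} s" for s
    by (auto simp: indicator_def)
  have 3: "emeasure lborel {a<..<b} = ennreal (b - a)" for a b :: real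
    by (cases "a \<le> b") (auto simp: ennreal_neg)
  show ?thesis unfolding bregman_layer_def 1 2
    by (subst nn_integral_add) (auto simp: nn_integral_cmult 3)
qed

text \<open>For \<open>x \<le> z\<close> the fundamental theorem of calculus writes the divergence
  as the integral of \<open>d t - d x\<close> over [x, z], and the inner integral of the layers is
  this integrand. The case \<open>z \<le> x\<close> is symmetric.\<close>

lemma bregman_divergence_eq_integral:
  assumes gen: "bregman_generator D \<phi>" and x: "x \<in> D" and z: "z \<in> D"
  shows "ennreal (bregman_divergence D \<phi> z x) =
    (\<integral>\<^sup>+ t. \<integral>\<^sup>+ s. bregman_layer D (gradient D \<phi>) z x t s \<partial>lborel \<partial>lborel)"
proof -
  define d where "d = gradient D \<phi>"
  have "is_interval D"
    using gen by (auto simp: bregman_generator_def is_interval_convex_1 dest: convex_on_imp_convex)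
  then have Dsub: "{a..b} \<subseteq> D" if "a \<in> D" "b \<in> D" for a b
    using mem_is_interval_1_I[OF _ that] by (meson atLeastAtMost_iff subsetI)
  have mono: "d a \<le> d b" if "a \<in> D" "b \<in> D" "a \<le> b" for a b
    unfolding d_def by (rule mono_onD[OF gradient_mono_on[OF gen] that])
  have deriv: "(\<phi> has_vector_derivative d t) (at t within {a..b})"
    if "a \<in> D" "b \<in> D" "t \<in> {a..b}" for a b t
  proof -
    have "(\<phi> has_derivative (\<lambda>h. d t \<bullet> h)) (at t within {a..b})"
      unfolding d_def
      by (rule has_derivative_subset[OF has_derivative_gradient[OF gen] Dsub]) (use that Dsub[OF that(1,2)] in auto)
    then show ?thesis by (simp add: has_vector_derivative_def mult.commute)
  qed
  \<comment> \<open>Extension by 0 turns the monotone derivative on a subinterval into a Borel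
    function on the whole line.\<close>
  have meas: "(\<lambda>t. if t \<in> {a..b} then d t else 0) \<in> borel_measurable borel"
    if "a \<in> D" "b \<in> D" for a b
    by (subst measurable_restrict_space_iff[symmetric])
       (use Dsub[OF that] in \<open>auto intro!: borel_measurable_mono_on_fnc mono_onI mono\<close>)
  show ?thesis
  proof (cases "x \<le> z")
    case True
    let ?g = "\<lambda>t. if t \<in> {x..z} then d t - d x else 0"
    have "?g = (\<lambda>t. (if t \<in> {x..z} then d t else 0) - (if t \<in> {x..z} then d x else 0))" by auto
    then have g: "?g \<in> borel_measurable borel" using meas[OF x z] by simp
    have "(?g has_integral ((\<phi> z - \<phi> x) - (z - x) * d x)) UNIV"
      using has_integral_diff[OF fundamental_theorem_of_calculus[OF True deriv[OF x z]]
          has_integral_const_real[of "d x" x z]] True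
      unfolding has_integral_restrict_UNIV by simp
    then have "(\<integral>\<^sup>+ t. ?g t \<partial>lborel) = ennreal (bregman_divergence D \<phi> z x)"
      using mono[OF x _] Dsub[OF x z]
      by (subst nn_integral_has_integral_lborel[OF g])
         (auto simp: bregman_divergence_def d_def algebra_simps)
    \<comment> \<open>Off the interval both terms vanish: below \<open>x\<close> the increment
      \<open>d t - d x\<close> is not positive, and from \<open>z\<close> on
      \<open>d x - d t\<close> is not positive, so both are truncated.\<close>
    moreover have "ennreal (?g t) =
        (if t \<in> D \<and> t \<le> z then ennreal (d t - d x) else 0) +
        (if t \<in> D \<and> z \<le> t then ennreal (d x - d t) else 0)" for t
      using mono[of x t] mono[of t x] x z True subsetD[OF Dsub[OF x z], of t] by (auto simp: ennreal_neg)
    ultimately show ?thesis by (simp add: nn_integral_bregman_layer_inner flip: d_def)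
  next
    case False
    then have le: "z \<le> x" by simp
    let ?g = "\<lambda>t. if t \<in> {z..x} then d x - d t else 0"
    have "?g = (\<lambda>t. (if t \<in> {z..x} then d x else 0) - (if t \<in> {z..x} then d t else 0))" by auto
    then have g: "?g \<in> borel_measurable borel" using meas[OF z x] by simp
    have "(?g has_integral ((x - z) * d x - (\<phi> x - \<phi> z))) UNIV"
      using has_integral_diff[OF has_integral_const_real[of "d x" z x]
          fundamental_theorem_of_calculus[OF le deriv[OF z x]]] le
      unfolding has_integral_restrict_UNIV by simp
    then have "(\<integral>\<^sup>+ t. ?g t \<partial>lborel) = ennreal (bregman_divergence D \<phi> z x)"
      using mono[OF _ x] Dsub[OF z x]
      by (subst nn_integral_has_integral_lborel[OF g])
         (auto simp: bregman_divergence_def d_def algebra_simps)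
    moreover have "ennreal (?g t) =
        (if t \<in> D \<and> t \<le> z then ennreal (d t - d x) else 0) +
        (if t \<in> D \<and> z \<le> t then ennreal (d x - d t) else 0)" for t
      using mono[of x t] mono[of t x] x z False subsetD[OF Dsub[OF z x], of t] by (auto simp: ennreal_neg)
    ultimately show ?thesis by (simp add: nn_integral_bregman_layer_inner flip: d_def)
  qed
qed

section \<open>Distribution functions, comonotonicity and quantiles\<close>

lemma joint_cdf_eq_measure_distr:
  assumes "X \<in> borel_measurable M"
  shows "joint_cdf M X x = measure (distr M borel X) {..x}"
  using assms by (simp add: joint_cdf_def measure_distr vimage_def Int_def conj_commute)

text \<open>The lower orthants are closed under intersection, by componentwise infima, generate the
  Borel sets, and exhaust the space along multiples of \<open>One\<close>.\<close>

lemma (in prob_space) distr_eqI_joint_cdf: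
  fixes X Y :: "'a \<Rightarrow> 'b::ordered_euclidean_space"
  assumes X: "X \<in> borel_measurable M" and Y: "Y \<in> borel_measurable M"
    and eq: "joint_cdf M X = joint_cdf M Y"
  shows "distr M borel X = distr M borel Y"
proof -
  interpret X: prob_space "distr M borel X" by (rule prob_space_distr[OF X])
  interpret Y: prob_space "distr M borel Y" by (rule prob_space_distr[OF Y])
  let ?E = "range (\<lambda>a::'b. {..a})"
  show ?thesis
  proof (rule measure_eqI_generator_eq[where \<Omega> = UNIV and E = ?E and A = "\<lambda>n. {..real n *\<^sub>R One}"])
    show "Int_stable ?E"
    proof (rule Int_stableI)
      fix a b assume "a \<in> ?E" "b \<in> ?E"
      then obtain x y where "a = {..x}" "b = {..y}" by auto
      then have "a \<inter> b = {..inf x y}" by auto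
      then show "a \<inter> b \<in> ?E" by blast
    qed
    show "emeasure (distr M borel X) A = emeasure (distr M borel Y) A" if "A \<in> ?E" for A
      using that fun_cong[OF eq]
      by (auto simp: X.emeasure_eq_measure Y.emeasure_eq_measure
          joint_cdf_eq_measure_distr[OF X] joint_cdf_eq_measure_distr[OF Y])
    show "(\<Union>n. {..real n *\<^sub>R One}) = (UNIV :: 'b set)"
    proof (intro equalityI subsetI)
      fix x :: 'b
      obtain n :: nat where "norm x \<le> real n" using real_arch_simple by blast
      then have "x \<le> real n *\<^sub>R One"
        by (auto simp: eucl_le[where 'a='b] intro: order_trans[OF abs_ge_self] order_trans[OF Basis_le_norm])
      then show "x \<in> (\<Union>n. {..real n *\<^sub>R One})" by auto
    qed simp
    show "sets (distr M borel X) = sigma_sets UNIV ?E" "sets (distr M borel Y) = sigma_sets UNIV ?E"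
      by (simp_all add: borel_eq_atMost)
  qed auto
qed

lemma distr_eq_compose:
  assumes "X \<in> M \<rightarrow>\<^sub>M N" "Y \<in> M \<rightarrow>\<^sub>M N" "f \<in> N \<rightarrow>\<^sub>M L" "distr M N X = distr M N Y"
  shows "distr M L (\<lambda>\<omega>. f (X \<omega>)) = distr M L (\<lambda>\<omega>. f (Y \<omega>))"
  using distr_distr[OF assms(3,1)] distr_distr[OF assms(3,2)] assms(4) by (simp add: comp_def)

section \<open>Random vectors with values in a prescribed domain\<close>

lemma random_vectorsD:
  assumes "X \<in> random_vectors M S"
  shows "X \<in> borel_measurable M" "\<And>\<omega>. \<omega> \<in> space M \<Longrightarrow> X \<omega> \<in> S"
  using assms by (auto simp: random_vectors_def measurable_restrict_space2_iff)

lemma random_vectorsI: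
  assumes "X \<in> borel_measurable M" "\<And>\<omega>. \<omega> \<in> space M \<Longrightarrow> X \<omega> \<in> S"
  shows "X \<in> random_vectors M S"
  using assms by (auto simp: random_vectors_def measurable_restrict_space2_iff)

lemma borel_measurable_vec_iff_nth:
  fixes X :: "'w \<Rightarrow> real ^ 'n"
  shows "X \<in> borel_measurable M \<longleftrightarrow> (\<forall>i. (\<lambda>\<omega>. X \<omega> $ i) \<in> borel_measurable M)"
proof
  assume X: "X \<in> borel_measurable M"
  have "(\<lambda>x :: real ^ 'n. x $ i) \<in> borel_measurable borel" for i
    by (intro borel_measurable_continuous_onI continuous_intros)
  then show "\<forall>i. (\<lambda>\<omega>. X \<omega> $ i) \<in> borel_measurable M"
    using measurable_compose[OF X] by blast
next
  assume "\<forall>i. (\<lambda>\<omega>. X \<omega> $ i) \<in> borel_measurable M"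
  then show "X \<in> borel_measurable M"
    by (subst borel_measurable_euclidean_space) (auto simp: Basis_vec_def inner_axis)
qed

lemma random_vectors_cart_power_iff:
  fixes X :: "'w \<Rightarrow> real ^ 'n"
  shows "X \<in> random_vectors M (cart_power D) \<longleftrightarrow> (\<forall>i. (\<lambda>\<omega>. X \<omega> $ i) \<in> random_vectors M D)"
  by (auto simp: random_vectors_def measurable_restrict_space2_iff cart_power_def
      borel_measurable_vec_iff_nth Pi_iff)

section \<open>Comonotonic vectors, quantile transforms and a probability bound\<close>

lemma (in prob_space) comonotonic_mono_on:
  assumes "\<And>\<omega>. \<omega> \<in> space M \<Longrightarrow> U \<omega> \<in> S" "mono_on S f" "mono_on S g"
  shows "comonotonic M (\<lambda>\<omega>. f (U \<omega> :: 'b::linorder)) (\<lambda>\<omega>. g (U \<omega>))"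
  unfolding comonotonic_def
proof (intro bexI[of _ "space M"] conjI ballI)
  fix \<omega> \<omega>' assume w: "\<omega> \<in> space M" "\<omega>' \<in> space M"
  then have mono: "U \<omega>1 \<le> U \<omega>2 \<Longrightarrow> f (U \<omega>1) \<le> f (U \<omega>2) \<and> g (U \<omega>1) \<le> g (U \<omega>2)"
    if "\<omega>1 \<in> {\<omega>, \<omega>'}" "\<omega>2 \<in> {\<omega>, \<omega>'}" for \<omega>1 \<omega>2
    using that assms by (metis mono_onD insertE singletonD)
  show "0 \<le> (f (U \<omega>) - f (U \<omega>')) * (g (U \<omega>) - g (U \<omega>'))"
    using mono[of \<omega> \<omega>'] mono[of \<omega>' \<omega>] linear[of "U \<omega>" "U \<omega>'"]
    by (auto simp: zero_le_mult_iff)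
qed (auto simp: prob_space)

text \<open>Comonotonicity makes the sublevel events of the components nested up to a null set, so
  their intersection is the smallest of them. Hence the law of a comonotonic vector is fixed by its
  marginals.\<close>

lemma (in prob_space) joint_cdf_comonotonic_vector:
  fixes X :: "'a \<Rightarrow> real ^ 'n"
  assumes X: "X \<in> borel_measurable M" and com: "comonotonic_vector M X"
  shows "joint_cdf M X x = (MIN i. joint_cdf M (\<lambda>\<omega>. X \<omega> $ i) (x $ i))"
proof -
  have [measurable]: "(\<lambda>\<omega>. X \<omega> $ i) \<in> borel_measurable M" for i
    using X by (simp add: borel_measurable_vec_iff_nth)
  have "\<forall>i j. \<exists>A. A \<in> events \<and> prob A = 1 \<and>
      (\<forall>\<omega>\<in>A. \<forall>\<omega>'\<in>A. 0 \<le> (X \<omega> $ i - X \<omega>' $ i) * (X \<omega> $ j - X \<omega>' $ j))"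
    using com unfolding comonotonic_vector_def comonotonic_def by blast
  then obtain A where A: "\<And>i j. A i j \<in> events" "\<And>i j. prob (A i j) = 1"
    "\<And>i j \<omega> \<omega>'. \<omega> \<in> A i j \<Longrightarrow> \<omega>' \<in> A i j \<Longrightarrow> 0 \<le> (X \<omega> $ i - X \<omega>' $ i) * (X \<omega> $ j - X \<omega>' $ j)"
    by (subst (asm) choice_iff, subst (asm) choice_iff) blast
  \<comment> \<open>Each pair of components has its own set of full measure; there are finitely many
    pairs, so one common set works.\<close>
  define N where "N = (\<Inter>i. \<Inter>j. A i j)"
  have N: "N \<in> events" unfolding N_def by (intro sets.finite_INT) (auto simp: A)
  have AE_N: "AE \<omega> in M. \<omega> \<in> N"
    unfolding N_def using AE_prob_1[OF A(2)] by (simp add: AE_all_countable)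
  define E where "E i = {\<omega> \<in> space M. X \<omega> $ i \<le> x $ i}" for i
  have E[measurable]: "E i \<in> events" for i unfolding E_def by measurable
  have total: "N \<inter> E i \<subseteq> N \<inter> E j \<or> N \<inter> E j \<subseteq> N \<inter> E i" for i j
  proof (rule ccontr)
    assume "\<not> ?thesis"
    then obtain \<omega> \<omega>' where w: "\<omega> \<in> N" "\<omega> \<in> E i" "\<omega> \<notin> E j" "\<omega>' \<in> N" "\<omega>' \<in> E j" "\<omega>' \<notin> E i"
      by blast
    then have "\<omega> \<in> space M" "\<omega>' \<in> space M" by (auto simp: E_def)
    with w have "X \<omega> $ i < X \<omega>' $ i" "X \<omega>' $ j < X \<omega> $ j" by (auto simp: E_def)
    then have "(X \<omega> $ i - X \<omega>' $ i) * (X \<omega> $ j - X \<omega>' $ j) < 0"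
      by (intro mult_neg_pos) auto
    moreover have "\<omega> \<in> A i j" "\<omega>' \<in> A i j" using w by (auto simp: N_def)
    ultimately show False using A(3)[of \<omega> i j \<omega>'] by simp
  qed
  \<comment> \<open>A finite family has a minimal member, and in a chain a minimal member is the
    least one.\<close>
  obtain k where k: "\<And>j. N \<inter> E k \<subseteq> N \<inter> E j"
  proof -
    have "\<exists>m\<in>range (\<lambda>i. N \<inter> E i). \<forall>b\<in>range (\<lambda>i. N \<inter> E i). b \<subseteq> m \<longrightarrow> m = b"
      by (rule finite_has_minimal) auto
    then obtain K where K: "K \<in> range (\<lambda>i. N \<inter> E i)"
      "\<forall>b\<in>range (\<lambda>i. N \<inter> E i). b \<subseteq> K \<longrightarrow> K = b"
      by (rule bexE)
    obtain m where m: "K = N \<inter> E m" using K(1) by (rule rangeE)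
    show ?thesis
    proof (rule that)
      fix j
      from total[of m j] show "N \<inter> E m \<subseteq> N \<inter> E j"
      proof
        assume "N \<inter> E j \<subseteq> N \<inter> E m"
        with K(2)[THEN bspec, OF rangeI[of _ j]] have "N \<inter> E m = N \<inter> E j" unfolding m by (rule mp)
        then show ?thesis by (rule equalityD1)
      qed
    qed
  qed
  have prob_N: "prob (N \<inter> B) = prob B" if "B \<in> events" for B
    by (rule finite_measure_eq_AE) (use AE_N N that in auto)
  have marg: "joint_cdf M (\<lambda>\<omega>. X \<omega> $ i) (x $ i) = prob (E i)" for i
    by (simp add: joint_cdf_def E_def)
  have le: "prob (E k) \<le> prob (E j)" for j
    using finite_measure_mono[OF k[of j]] N prob_N[of "E k"] prob_N[of "E j"] by simp
  have "joint_cdf M X x = prob (\<Inter>i. E i)"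
    unfolding joint_cdf_def by (rule arg_cong[where f = prob]) (auto simp: less_eq_vec_def E_def)
  also have "\<dots> = prob (N \<inter> (\<Inter>i. E i))"
    by (rule prob_N[symmetric]) (intro sets.finite_INT, auto)
  also have "N \<inter> (\<Inter>i. E i) = N \<inter> E k" using k by blast
  also have "prob \<dots> = (MIN i. prob (E i))"
    unfolding prob_N[OF E] by (rule Min_eqI[symmetric]) (auto simp: le)
  finally show ?thesis by (simp add: marg)
qed

text \<open>The left-continuous inverse of the cdf satisfies \<open>q u \<le> x\<close> iff
  \<open>u \<le> C x\<close>, so \<open>q (U \<omega>)\<close> has the cdf of \<open>Z\<close>. Its
  values must lie in \<open>D\<close> everywhere and not merely almost surely, because
  \<open>random_vectors\<close> asks for that.\<close>

lemma (in prob_space) quantile_transform: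
  fixes Z U :: "'a \<Rightarrow> real"
  assumes U: "U \<in> borel_measurable M" "\<And>\<omega>. U \<omega> \<in> {0<..<1}"
    "\<And>t. 0 \<le> t \<Longrightarrow> t \<le> 1 \<Longrightarrow> prob {\<omega> \<in> space M. U \<omega> \<le> t} = t"
    and D: "is_interval D" and Z: "Z \<in> random_vectors M D"
  obtains q where "mono_on {0<..<1} q" "(\<lambda>\<omega>. q (U \<omega>)) \<in> random_vectors M D"
    "joint_cdf M (\<lambda>\<omega>. q (U \<omega>)) = joint_cdf M Z"
proof -
  note Zm[measurable] = random_vectorsD(1)[OF Z]
  interpret Z: real_distribution "distr M borel Z" by (rule real_distribution_distr[OF Zm])
  interpret Z: cdf_distribution "distr M borel Z" ..
  have C: "Z.C x = joint_cdf M Z x" for x by (simp add: cdf_def joint_cdf_eq_measure_distr)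
  define q where "q u = Z.I u" for u
  have le_iff: "u \<le> Z.C x \<longleftrightarrow> q u \<le> x" if "u \<in> {0<..<1}" for u x
    using that unfolding q_def by (intro Z.pseudoinverse) auto
  have q_mono: "mono_on {0<..<1} q" unfolding q_def by (rule Z.mono_I)
  have q_meas: "q \<in> borel_measurable (restrict_space borel {0<..<1})"
    unfolding q_def by (rule Z.measurable_CI)
  show thesis
  proof
    show "mono_on {0<..<1} q" by (rule q_mono)
    have "U \<in> M \<rightarrow>\<^sub>M restrict_space borel {0<..<1}"
      using U(1,2) by (simp add: measurable_restrict_space2_iff)
    then have "(\<lambda>\<omega>. q (U \<omega>)) \<in> borel_measurable M"
      by (rule measurable_compose[OF _ q_meas])
    moreover have "q u \<in> D" if u: "u \<in> {0<..<1}" for u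
    proof (rule ccontr)
      \<comment> \<open>Outside the interval \<open>D\<close>, the point \<open>q u\<close> has all
        of \<open>D\<close> on one side. If \<open>D\<close> lies above, the cdf is 0 at
        \<open>q u\<close>, although it is at least u > 0. If \<open>D\<close> lies below, the cdf
        tends to 1 from the left of \<open>q u\<close> and exceeds u at some smaller point, against
        the choice of \<open>q u\<close>.\<close>
      assume nD: "q u \<notin> D"
      obtain z0 where z0: "z0 \<in> D" using not_empty random_vectorsD(2)[OF Z] by blast
      show False
      proof (cases "q u < z0")
        case True
        then have "q u < z" if "z \<in> D" for z
          using nD z0 that mem_is_interval_1_I[OF D that z0, of "q u"] by (cases "z \<le> q u") auto
        then have "{\<omega> \<in> space M. Z \<omega> \<le> q u} = {}"
          using random_vectorsD(2)[OF Z] by (force simp: not_le[symmetric])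
        then have "Z.C (q u) = 0" unfolding C joint_cdf_def by (metis measure_empty)
        moreover have "u \<le> Z.C (q u)" using le_iff[OF u] by simp
        ultimately show False using u by simp
      next
        case False
        then have less: "z < q u" if "z \<in> D" for z
          using nD z0 that mem_is_interval_1_I[OF D z0 that, of "q u"] by (cases "q u \<le> z") auto
        have "Z -` {..<q u} \<inter> space M = space M"
          using less[OF random_vectorsD(2)[OF Z]] by blast
        then have "measure (distr M borel Z) {..<q u} = prob (space M)"
          by (simp add: measure_distr)
        then have "(Z.C \<longlongrightarrow> 1) (at_left (q u))"
          using Z.cdf_at_left[of "q u"] by (simp add: prob_space)
        then have "\<forall>\<^sub>F x in at_left (q u). u < Z.C x"
          using u by (auto dest: order_tendstoD)
        moreover have "\<forall>\<^sub>F x in at_left (q u). x < q u"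
          by (auto simp: eventually_at_filter)
        ultimately have "\<forall>\<^sub>F x in at_left (q u). False"
          by eventually_elim (meson le_iff[OF u] less_imp_le not_le)
        then show False by simp
      qed
    qed
    ultimately show "(\<lambda>\<omega>. q (U \<omega>)) \<in> random_vectors M D"
      by (intro random_vectorsI) (simp_all only: U(2))
    show "joint_cdf M (\<lambda>\<omega>. q (U \<omega>)) = joint_cdf M Z"
    proof
      fix x
      have "joint_cdf M (\<lambda>\<omega>. q (U \<omega>)) x = prob {\<omega> \<in> space M. U \<omega> \<le> Z.C x}"
        unfolding joint_cdf_def using le_iff[OF U(2)] by simp
      also have "\<dots> = Z.C x" by (rule U(3)) (simp_all add: Z.cdf_nonneg Z.cdf_bounded_prob)
      finally show "joint_cdf M (\<lambda>\<omega>. q (U \<omega>)) x = joint_cdf M Z x" by (simp add: C)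
    qed
  qed
qed

text \<open>For given marginal probabilities, an intersection has probability at least the larger of
  0 and prob P + prob Q - 1. The two alternatives on \<open>N\<close> are the cases where the primed
  events attain one of these bounds.\<close>

lemma (in prob_space) prob_Int_le_if_nested:
  assumes ev: "P \<in> events" "Q \<in> events" "P' \<in> events" "Q' \<in> events"
    and eq: "prob P' = prob P" "prob Q' = prob Q"
    and N: "prob N = 1" "N \<inter> (P' \<inter> Q') = {} \<or> N \<subseteq> P' \<union> Q'"
  shows "prob (P' \<inter> Q') \<le> prob (P \<inter> Q)"
  using N(2)
proof
  assume "N \<inter> (P' \<inter> Q') = {}"
  then have "AE \<omega> in M. \<omega> \<notin> P' \<inter> Q'"
    using AE_prob_1[OF N(1)] by (auto elim!: eventually_mono)
  then have "prob (P' \<inter> Q') = 0" using ev by (subst prob_eq_0) auto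
  then show ?thesis by simp
next
  assume "N \<subseteq> P' \<union> Q'"
  then have "AE \<omega> in M. \<omega> \<in> P' \<union> Q'"
    using AE_prob_1[OF N(1)] by (auto elim!: eventually_mono)
  then have 1: "prob (P' \<union> Q') = 1" using ev by (subst (asm) AE_in_set_eq_1) auto
  have un: "prob (A \<union> B) = prob A + prob B - prob (A \<inter> B)" if "A \<in> events" "B \<in> events" for A B
    using measure_Un3[of A M B] that by (simp add: fmeasurable_eq_sets)
  show ?thesis
    using un[of P Q] un[of P' Q'] prob_le_1[of "P \<union> Q"] 1 ev eq by simp
qed

section \<open>Comonotonic couplings and uncertainty sets\<close>

text \<open>After exchanging integrals the expected divergence depends on the coupling only through
  the probabilities of \<open>upp\<close> and \<open>low\<close>. For fixed marginal laws a
  comonotonic pair attains the lower bound for each of them, at every t and s.\<close>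

lemma (in prob_space) bregman_comonotonic_optimal:
  fixes D :: "real set"
  assumes gen: "bregman_generator D \<phi>"
    and rv: "Z \<in> random_vectors M D" "X \<in> random_vectors M D"
      "Z' \<in> random_vectors M D" "X' \<in> random_vectors M D"
    and law: "distr M borel Z' = distr M borel Z" "distr M borel X' = distr M borel X"
    and com: "comonotonic M Z' X'"
  shows "(\<integral>\<^sup>+ \<omega>. ennreal (bregman_divergence D \<phi> (Z' \<omega>) (X' \<omega>)) \<partial>M)
    \<le> (\<integral>\<^sup>+ \<omega>. ennreal (bregman_divergence D \<phi> (Z \<omega>) (X \<omega>)) \<partial>M)"
proof -
  \<comment> \<open>The gradient is measurable only within \<open>D\<close>; extending it by 0 gives
    a Borel function on the line, so that the layers are jointly measurable.\<close>
  define d where "d t = (if t \<in> D then gradient D \<phi> t else 0)" for t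
  note [measurable] = borel_measurable_gradient(1)[OF gen]
  have d_meas [measurable]: "d \<in> borel_measurable borel"
    unfolding d_def using borel_measurable_gradient[OF gen]
    by (subst measurable_restrict_space_iff[symmetric]) auto
  have d_mono: "d x \<le> d y" if "x \<in> D" "y \<in> D" "x \<le> y" for x y
    using mono_onD[OF gradient_mono_on[OF gen] that] that by (simp add: d_def)
  define upp where "upp Z X t s = {\<omega> \<in> space M. d (X \<omega>) < s} \<inter> {\<omega> \<in> space M. t \<le> Z \<omega>}"
    for Z X :: "'a \<Rightarrow> real" and t s
  define low where "low Z X t s = {\<omega> \<in> space M. Z \<omega> \<le> t} \<inter> {\<omega> \<in> space M. s < d (X \<omega>)}"
    for Z X :: "'a \<Rightarrow> real" and t s
  have repr: "(\<integral>\<^sup>+ \<omega>. ennreal (bregman_divergence D \<phi> (Z \<omega>) (X \<omega>)) \<partial>M) =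
      (\<integral>\<^sup>+ t. \<integral>\<^sup>+ s. (if t \<in> D \<and> s < d t then ennreal (prob (upp Z X t s)) else 0) +
        (if t \<in> D \<and> d t < s then ennreal (prob (low Z X t s)) else 0) \<partial>lborel \<partial>lborel)"
    if Z: "Z \<in> random_vectors M D" and X: "X \<in> random_vectors M D" for Z X
  proof -
    note [measurable] = random_vectorsD(1)[OF Z] random_vectorsD(1)[OF X]
    interpret MR: pair_sigma_finite M "lborel :: real measure" ..
    define K where "K \<omega> t s =
      (if t \<in> D \<and> d (X \<omega>) < s \<and> s < d t \<and> t \<le> Z \<omega> then 1 else 0 :: ennreal) +
      (if t \<in> D \<and> d t < s \<and> s < d (X \<omega>) \<and> Z \<omega> \<le> t then 1 else 0)" for \<omega> t s
    have inner: "(\<integral>\<^sup>+ \<omega>. K \<omega> t s \<partial>M) =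
        (if t \<in> D \<and> s < d t then ennreal (prob (upp Z X t s)) else 0) +
        (if t \<in> D \<and> d t < s then ennreal (prob (low Z X t s)) else 0)" for t s
    proof -
      have "(\<integral>\<^sup>+ \<omega>. K \<omega> t s \<partial>M) =
        (\<integral>\<^sup>+ \<omega>. (if t \<in> D \<and> s < d t then 1 else 0) * indicator (upp Z X t s) \<omega> +
          (if t \<in> D \<and> d t < s then 1 else 0) * indicator (low Z X t s) \<omega> \<partial>M)"
        by (rule nn_integral_cong) (auto simp: K_def upp_def low_def indicator_def)
      also have "\<dots> = (if t \<in> D \<and> s < d t then 1 else 0) * emeasure M (upp Z X t s) +
          (if t \<in> D \<and> d t < s then 1 else 0) * emeasure M (low Z X t s)"
      proof -
        have [measurable]: "upp Z X t s \<in> events" "low Z X t s \<in> events"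
          unfolding upp_def low_def by measurable
        show ?thesis by (subst nn_integral_add) (auto simp: nn_integral_cmult_indicator)
      qed
      finally show ?thesis by (simp add: emeasure_eq_measure)
    qed
    have "(\<integral>\<^sup>+ \<omega>. ennreal (bregman_divergence D \<phi> (Z \<omega>) (X \<omega>)) \<partial>M) =
        (\<integral>\<^sup>+ \<omega>. \<integral>\<^sup>+ t. \<integral>\<^sup>+ s. K \<omega> t s \<partial>lborel \<partial>lborel \<partial>M)"
    proof (rule nn_integral_cong)
      fix \<omega> assume "\<omega> \<in> space M"
      then have "Z \<omega> \<in> D" "X \<omega> \<in> D"
        using random_vectorsD(2)[OF Z] random_vectorsD(2)[OF X] by blast+
      moreover from this have "K \<omega> t s = bregman_layer D (gradient D \<phi>) (Z \<omega>) (X \<omega>) t s" for t s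
        by (auto simp: K_def bregman_layer_def d_def)
      ultimately show "ennreal (bregman_divergence D \<phi> (Z \<omega>) (X \<omega>)) = (\<integral>\<^sup>+ t. \<integral>\<^sup>+ s. K \<omega> t s \<partial>lborel \<partial>lborel)"
        by (simp add: bregman_divergence_eq_integral[OF gen])
    qed
    \<comment> \<open>The integral over the sample space moves inwards in two exchanges, first past
      t and then, for each fixed t, past s.\<close>
    also have "\<dots> = (\<integral>\<^sup>+ t. \<integral>\<^sup>+ \<omega>. \<integral>\<^sup>+ s. K \<omega> t s \<partial>lborel \<partial>M \<partial>lborel)"
      by (rule MR.Fubini'[symmetric]) (unfold K_def, measurable)
    also have "\<dots> = (\<integral>\<^sup>+ t. \<integral>\<^sup>+ s. \<integral>\<^sup>+ \<omega>. K \<omega> t s \<partial>M \<partial>lborel \<partial>lborel)"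
      by (rule nn_integral_cong, rule MR.Fubini'[symmetric]) (unfold K_def, measurable)
    finally show ?thesis by (simp only: inner)
  qed
  obtain N where N: "prob N = 1"
    "\<And>\<omega> \<omega>'. \<omega> \<in> N \<Longrightarrow> \<omega>' \<in> N \<Longrightarrow> 0 \<le> (Z' \<omega> - Z' \<omega>') * (X' \<omega> - X' \<omega>')" "N \<in> events"
    using com unfolding comonotonic_def by metis
  have NM: "\<omega> \<in> space M" if "\<omega> \<in> N" for \<omega> using sets.sets_into_space[OF N(3)] that by blast
  note [measurable] = rv[THEN random_vectorsD(1)]
  have prob_eq: "prob {\<omega> \<in> space M. P (Y' \<omega>)} = prob {\<omega> \<in> space M. P (Y \<omega>)}"
    if "distr M borel Y' = distr M borel Y" "Y \<in> borel_measurable M" "Y' \<in> borel_measurable M"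
      "Measurable.pred borel P" for Y Y' :: "'a \<Rightarrow> real" and P
  proof -
    have "prob {\<omega> \<in> space M. P (Y \<omega>)} = measure (distr M borel Y) {x. P x}"
      if "Y \<in> borel_measurable M" for Y
      using that \<open>Measurable.pred borel P\<close>
      by (subst measure_distr) (auto simp: vimage_def Int_def conj_commute pred_def)
    with that show ?thesis by simp
  qed
  have Z'X': "\<not> (Z' \<omega>' < Z' \<omega> \<and> X' \<omega> < X' \<omega>')" if "\<omega> \<in> N" "\<omega>' \<in> N" for \<omega> \<omega>'
    using N(2)[OF that] by (auto simp: zero_le_mult_iff)
  have dX': "X' \<omega> < X' \<omega>'" if "\<omega> \<in> N" "\<omega>' \<in> N" "d (X' \<omega>) < d (X' \<omega>')" for \<omega> \<omega>'
    using d_mono[of "X' \<omega>'" "X' \<omega>"] that NM random_vectorsD(2)[OF rv(4)] by force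
  have upp_le: "prob (upp Z' X' t s) \<le> prob (upp Z X t s)" for t s
    unfolding upp_def
  proof (rule prob_Int_le_if_nested[OF _ _ _ _ _ _ N(1)])
    show "prob {\<omega> \<in> space M. d (X' \<omega>) < s} = prob {\<omega> \<in> space M. d (X \<omega>) < s}"
      by (rule prob_eq[OF law(2)]) measurable
    show "prob {\<omega> \<in> space M. t \<le> Z' \<omega>} = prob {\<omega> \<in> space M. t \<le> Z \<omega>}"
      by (rule prob_eq[OF law(1)]) measurable
    \<comment> \<open>If both alternatives failed, some point of \<open>N\<close> would lie in both
      events and another in neither. Between them \<open>X'\<close> would strictly increase and
      \<open>Z'\<close> strictly decrease.\<close>
    show "N \<inter> ({\<omega> \<in> space M. d (X' \<omega>) < s} \<inter> {\<omega> \<in> space M. t \<le> Z' \<omega>}) = {} \<or>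
      N \<subseteq> {\<omega> \<in> space M. d (X' \<omega>) < s} \<union> {\<omega> \<in> space M. t \<le> Z' \<omega>}"
    proof (rule ccontr)
      assume "\<not> ?thesis"
      then obtain \<omega> \<omega>' where w: "\<omega> \<in> N" "d (X' \<omega>) < s" "t \<le> Z' \<omega>"
          "\<omega>' \<in> N" "\<not> d (X' \<omega>') < s" "\<not> t \<le> Z' \<omega>'"
        using NM by blast
      then show False using Z'X'[of \<omega> \<omega>'] dX'[of \<omega> \<omega>'] by auto
    qed
  qed measurable
  have low_le: "prob (low Z' X' t s) \<le> prob (low Z X t s)" for t s
    unfolding low_def
  proof (rule prob_Int_le_if_nested[OF _ _ _ _ _ _ N(1)])
    show "prob {\<omega> \<in> space M. s < d (X' \<omega>)} = prob {\<omega> \<in> space M. s < d (X \<omega>)}"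
      by (rule prob_eq[OF law(2)]) measurable
    show "prob {\<omega> \<in> space M. Z' \<omega> \<le> t} = prob {\<omega> \<in> space M. Z \<omega> \<le> t}"
      by (rule prob_eq[OF law(1)]) measurable
    show "N \<inter> ({\<omega> \<in> space M. Z' \<omega> \<le> t} \<inter> {\<omega> \<in> space M. s < d (X' \<omega>)}) = {} \<or>
      N \<subseteq> {\<omega> \<in> space M. Z' \<omega> \<le> t} \<union> {\<omega> \<in> space M. s < d (X' \<omega>)}"
    proof (rule ccontr)
      assume "\<not> ?thesis"
      then obtain \<omega> \<omega>' where w: "\<omega> \<in> N" "s < d (X' \<omega>)" "Z' \<omega> \<le> t"
          "\<omega>' \<in> N" "\<not> s < d (X' \<omega>')" "\<not> Z' \<omega>' \<le> t"
        using NM by blast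
      then show False using Z'X'[of \<omega>' \<omega>] dX'[of \<omega>' \<omega>] by auto
    qed
  qed measurable
  show ?thesis
    unfolding repr[OF rv(3,4)] repr[OF rv(1,2)]
    by (intro nn_integral_mono add_mono) (auto intro!: ennreal_leI upp_le low_le)
qed

text \<open>The infimum is attained at the pair itself: a competing coupling has the same cdfs,
  hence the same marginal laws, and so cannot be cheaper.\<close>

lemma (in prob_space) bw_divergence_comonotonic:
  fixes D :: "real set"
  assumes gen: "bregman_generator D \<phi>"
    and rv: "Z \<in> random_vectors M D" "X \<in> random_vectors M D" and com: "comonotonic M Z X"
  shows "bw_divergence M D \<phi> (joint_cdf M Z) (joint_cdf M X) =
    (\<integral>\<^sup>+ \<omega>. ennreal (bregman_divergence D \<phi> (Z \<omega>) (X \<omega>)) \<partial>M)"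
proof (rule antisym)
  show "bw_divergence M D \<phi> (joint_cdf M Z) (joint_cdf M X) \<le>
      (\<integral>\<^sup>+ \<omega>. ennreal (bregman_divergence D \<phi> (Z \<omega>) (X \<omega>)) \<partial>M)"
    unfolding bw_divergence_def by (rule INF_lower2[of "(Z, X)"]) (use rv in auto)
  show "(\<integral>\<^sup>+ \<omega>. ennreal (bregman_divergence D \<phi> (Z \<omega>) (X \<omega>)) \<partial>M) \<le>
      bw_divergence M D \<phi> (joint_cdf M Z) (joint_cdf M X)"
    unfolding bw_divergence_def
  proof (rule INF_greatest, safe)
    fix Z' X' :: "'a \<Rightarrow> real"
    assume *: "Z' \<in> random_vectors M D" "X' \<in> random_vectors M D"
      "joint_cdf M Z' = joint_cdf M Z" "joint_cdf M X' = joint_cdf M X"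
    have "distr M borel Z = distr M borel Z'" "distr M borel X = distr M borel X'"
      by (intro distr_eqI_joint_cdf random_vectorsD(1)[OF rv(1)] random_vectorsD(1)[OF rv(2)]
          random_vectorsD(1)[OF *(1)] random_vectorsD(1)[OF *(2)] *(3,4)[symmetric])+
    then show "(\<integral>\<^sup>+ \<omega>. ennreal (bregman_divergence D \<phi> (Z \<omega>) (X \<omega>)) \<partial>M) \<le>
        (\<integral>\<^sup>+ \<omega>. ennreal (bregman_divergence D \<phi> (Z' \<omega>) (X' \<omega>)) \<partial>M)"
      by (rule bregman_comonotonic_optimal[OF gen *(1,2) rv _ _ com])
  qed
qed

section \<open>Uncertainty sets of a separable generator\<close>

lemma (in prob_space) joint_cdf_component_eq:
  fixes X Y :: "'a \<Rightarrow> real ^ 'n"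
  assumes "X \<in> borel_measurable M" "Y \<in> borel_measurable M" "joint_cdf M X = joint_cdf M Y"
  shows "joint_cdf M (\<lambda>\<omega>. X \<omega> $ i) = joint_cdf M (\<lambda>\<omega>. Y \<omega> $ i)"
proof
  fix x
  have "(\<lambda>x :: real ^ 'n. x $ i) \<in> borel_measurable borel"
    by (intro borel_measurable_continuous_onI continuous_intros)
  then have "distr M borel (\<lambda>\<omega>. X \<omega> $ i) = distr M borel (\<lambda>\<omega>. Y \<omega> $ i)"
    by (rule distr_eq_compose[OF assms(1,2) _ distr_eqI_joint_cdf[OF assms]])
  moreover have "(\<lambda>\<omega>. X \<omega> $ i) \<in> borel_measurable M" "(\<lambda>\<omega>. Y \<omega> $ i) \<in> borel_measurable M"
    using assms borel_measurable_vec_iff_nth by blast+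
  ultimately show "joint_cdf M (\<lambda>\<omega>. X \<omega> $ i) x = joint_cdf M (\<lambda>\<omega>. Y \<omega> $ i) x"
    by (simp add: joint_cdf_eq_measure_distr)
qed

locale separable_bregman = prob_space M for M :: "'w measure" +
  fixes D :: "real set" and \<Phi> :: "real ^ 'n \<Rightarrow> real" and \<phi> :: "'n \<Rightarrow> real \<Rightarrow> real"
    and X :: "'w \<Rightarrow> real ^ 'n"
  assumes nonatomic: "nonatomic M"
    and X: "X \<in> random_vectors M (cart_power D)"
    and gen: "bregman_generator (cart_power D) \<Phi>"
    and gens: "\<And>i. bregman_generator D (\<phi> i)"
    and sep: "\<And>x. x \<in> cart_power D \<Longrightarrow> \<Phi> x = (\<Sum>i\<in>UNIV. \<phi> i (x $ i))"
begin

text \<open>A coupling of vectors induces a coupling of their i-th components, whose cost is one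
  nonnegative summand of the full cost. Passing to infima preserves the inequality.\<close>

lemma bw_set_component:
  assumes "Z \<in> bw_set M (cart_power D) \<Phi> \<epsilon> X"
  shows "(\<lambda>\<omega>. Z \<omega> $ i) \<in> bw_set M D (\<phi> i) \<epsilon> (\<lambda>\<omega>. X \<omega> $ i)"
proof -
  have Z: "Z \<in> random_vectors M (cart_power D)"
    and le: "bw_divergence M (cart_power D) \<Phi> (joint_cdf M Z) (joint_cdf M X) \<le> ennreal \<epsilon>"
    using assms by (auto simp: bw_set_def)
  have "bw_divergence M D (\<phi> i) (joint_cdf M (\<lambda>\<omega>. Z \<omega> $ i)) (joint_cdf M (\<lambda>\<omega>. X \<omega> $ i)) \<le>
      bw_divergence M (cart_power D) \<Phi> (joint_cdf M Z) (joint_cdf M X)"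
    unfolding bw_divergence_def[of M "cart_power D"]
  proof (rule INF_greatest, safe)
    fix Z' X' :: "'w \<Rightarrow> real ^ 'n"
    assume *: "Z' \<in> random_vectors M (cart_power D)" "X' \<in> random_vectors M (cart_power D)"
      "joint_cdf M Z' = joint_cdf M Z" "joint_cdf M X' = joint_cdf M X"
    have eq: "joint_cdf M (\<lambda>\<omega>. Z' \<omega> $ i) = joint_cdf M (\<lambda>\<omega>. Z \<omega> $ i)"
      "joint_cdf M (\<lambda>\<omega>. X' \<omega> $ i) = joint_cdf M (\<lambda>\<omega>. X \<omega> $ i)"
      by (intro joint_cdf_component_eq random_vectorsD(1)[OF *(1)] random_vectorsD(1)[OF *(2)]
          random_vectorsD(1)[OF Z] random_vectorsD(1)[OF X] *(3,4))+
    have "bw_divergence M D (\<phi> i) (joint_cdf M (\<lambda>\<omega>. Z \<omega> $ i)) (joint_cdf M (\<lambda>\<omega>. X \<omega> $ i)) \<le>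
        (\<integral>\<^sup>+ \<omega>. ennreal (bregman_divergence D (\<phi> i) (Z' \<omega> $ i) (X' \<omega> $ i)) \<partial>M)"
      unfolding bw_divergence_def
      by (rule INF_lower2[of "(\<lambda>\<omega>. Z' \<omega> $ i, \<lambda>\<omega>. X' \<omega> $ i)"])
         (use * eq random_vectors_cart_power_iff in auto)
    also have "\<dots> \<le> (\<integral>\<^sup>+ \<omega>. ennreal (bregman_divergence (cart_power D) \<Phi> (Z' \<omega>) (X' \<omega>)) \<partial>M)"
    proof (intro nn_integral_mono ennreal_leI)
      fix \<omega> assume "\<omega> \<in> space M"
      then have ZX: "Z' \<omega> \<in> cart_power D" "X' \<omega> \<in> cart_power D" 
        by (rule random_vectorsD(2)[OF *(1)], rule random_vectorsD(2)[OF *(2)])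
      have "bregman_divergence D (\<phi> i) (Z' \<omega> $ i) (X' \<omega> $ i) \<le>
          (\<Sum>i\<in>UNIV. bregman_divergence D (\<phi> i) (Z' \<omega> $ i) (X' \<omega> $ i))"
        by (rule member_le_sum)
           (use ZX in \<open>auto simp: cart_power_def intro!: bregman_divergence_nonneg[OF gens]\<close>)
      also have "\<dots> = bregman_divergence (cart_power D) \<Phi> (Z' \<omega>) (X' \<omega>)"
        by (rule bregman_divergence_separable[OF gen gens sep ZX(2,1), symmetric])
      finally show "bregman_divergence D (\<phi> i) (Z' \<omega> $ i) (X' \<omega> $ i) \<le>
          bregman_divergence (cart_power D) \<Phi> (Z' \<omega>) (X' \<omega>)" .
    qed
    finally show "bw_divergence M D (\<phi> i) (joint_cdf M (\<lambda>\<omega>. Z \<omega> $ i)) (joint_cdf M (\<lambda>\<omega>. X \<omega> $ i)) \<le>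
        (\<integral>\<^sup>+ \<omega>. ennreal (bregman_divergence (cart_power D) \<Phi> (Z' \<omega>) (X' \<omega>)) \<partial>M)" .
  qed
  with le Z show ?thesis by (auto simp: bw_set_def random_vectors_cart_power_iff)
qed

text \<open>The \<open>Z i\<close> are chosen separately, so their joint law is arbitrary. Driving
  all coordinates by one uniform \<open>U\<close> keeps the marginals and makes each coordinate cost
  minimal, at most \<epsilon>/n; the n costs add up to at most \<epsilon>. \<open>U\<close> and
  \<open>q\<close> are returned because additivity of the risk will need monotone functions of a
  single variable.\<close>

lemma bw_set_comonotonic_rearrangement:
  assumes com: "comonotonic_vector M X" and "0 \<le> \<epsilon>"
    and Z: "\<And>i. Z i \<in> bw_set M D (\<phi> i) (\<epsilon> / real CARD('n)) (\<lambda>\<omega>. X \<omega> $ i)"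
  obtains U :: "'w \<Rightarrow> real" and q where "\<And>\<omega>. U \<omega> \<in> {0<..<1}" "\<And>i. mono_on {0<..<1} (q i)"
    "\<And>i. (\<lambda>\<omega>. q i (U \<omega>)) \<in> random_vectors M D"
    "\<And>i. joint_cdf M (\<lambda>\<omega>. q i (U \<omega>)) = joint_cdf M (Z i)"
    "(\<lambda>\<omega>. \<chi> i. q i (U \<omega>)) \<in> bw_set M (cart_power D) \<Phi> \<epsilon> X"
proof -
  obtain U :: "'w \<Rightarrow> real" where U: "U \<in> borel_measurable M" "\<And>\<omega>. U \<omega> \<in> {0<..<1}"
    "\<And>t. 0 \<le> t \<Longrightarrow> t \<le> 1 \<Longrightarrow> prob {\<omega> \<in> space M. U \<omega> \<le> t} = t"
    using nonatomic_imp_uniform_rv[OF nonatomic] by blast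
  \<comment> \<open>The domain is common to all \<open>\<phi> i\<close>, so any index shows that it
    is an interval.\<close>
  have D: "is_interval D"
    using gens[of undefined] by (auto simp: bregman_generator_def is_interval_convex_1 dest: convex_on_imp_convex)
  have "\<exists>q. mono_on {0<..<1} q \<and> (\<lambda>\<omega>. q (U \<omega>)) \<in> random_vectors M D \<and>
      joint_cdf M (\<lambda>\<omega>. q (U \<omega>)) = joint_cdf M Y" if "Y \<in> random_vectors M D" for Y
    using quantile_transform[OF U D that] by blast
  moreover have "Z i \<in> random_vectors M D" "(\<lambda>\<omega>. X \<omega> $ i) \<in> random_vectors M D" for i
    using Z[of i] X by (auto simp: bw_set_def random_vectors_cart_power_iff)
  ultimately have
    "\<forall>i. \<exists>q. mono_on {0<..<1} q \<and> (\<lambda>\<omega>. q (U \<omega>)) \<in> random_vectors M D \<and>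
       joint_cdf M (\<lambda>\<omega>. q (U \<omega>)) = joint_cdf M (Z i)"
    "\<forall>i. \<exists>r. mono_on {0<..<1} r \<and> (\<lambda>\<omega>. r (U \<omega>)) \<in> random_vectors M D \<and>
       joint_cdf M (\<lambda>\<omega>. r (U \<omega>)) = joint_cdf M (\<lambda>\<omega>. X \<omega> $ i)"
    by blast+
  then obtain q r where
    q: "\<And>i. mono_on {0<..<1} (q i)" "\<And>i. (\<lambda>\<omega>. q i (U \<omega>)) \<in> random_vectors M D"
      "\<And>i. joint_cdf M (\<lambda>\<omega>. q i (U \<omega>)) = joint_cdf M (Z i)"
    and r: "\<And>i. mono_on {0<..<1} (r i)" "\<And>i. (\<lambda>\<omega>. r i (U \<omega>)) \<in> random_vectors M D"
      "\<And>i. joint_cdf M (\<lambda>\<omega>. r i (U \<omega>)) = joint_cdf M (\<lambda>\<omega>. X \<omega> $ i)"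
    unfolding choice_iff by blast
  let ?Z = "\<lambda>\<omega>. \<chi> i. q i (U \<omega>)" and ?X = "\<lambda>\<omega>. \<chi> i. r i (U \<omega>)"
  have rv: "?Z \<in> random_vectors M (cart_power D)" "?X \<in> random_vectors M (cart_power D)"
    using q(2) r(2) by (simp_all add: random_vectors_cart_power_iff)
  have "comonotonic_vector M ?X"
    unfolding comonotonic_vector_def vec_lambda_beta
    by (intro allI comonotonic_mono_on[OF U(2) r(1) r(1)])
  \<comment> \<open>Comonotonicity of \<open>X\<close> enters here: \<open>X\<close> and
    \<open>?X\<close> have the same marginals, and for comonotonic vectors these determine the joint
    cdf.\<close>
  then have cdf_X: "joint_cdf M ?X = joint_cdf M X"
    using com rv(2) X
    by (intro ext) (simp add: joint_cdf_comonotonic_vector random_vectorsD(1) r(3))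
  let ?B = "\<lambda>i \<omega>. ennreal (bregman_divergence D (\<phi> i) (q i (U \<omega>)) (r i (U \<omega>)))"
  have B: "(\<integral>\<^sup>+ \<omega>. ?B i \<omega> \<partial>M) \<le> ennreal (\<epsilon> / real CARD('n))" for i
  proof -
    have "comonotonic M (\<lambda>\<omega>. q i (U \<omega>)) (\<lambda>\<omega>. r i (U \<omega>))"
      by (rule comonotonic_mono_on[OF U(2) q(1) r(1)])
    from bw_divergence_comonotonic[OF gens[of i] q(2)[of i] r(2)[of i] this] show ?thesis
      using Z[of i] by (simp add: bw_set_def q(3) r(3))
  qed
  \<comment> \<open>Additivity of the integral over the coordinates requires measurable costs:
    \<open>\<phi> i\<close> is continuous on \<open>D\<close> and its gradient is monotone.\<close>
  have B_meas: "?B i \<in> borel_measurable M" for i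
  proof -
    have \<phi>: "\<phi> i \<in> borel_measurable (restrict_space borel D)"
      using gens[of i] by (intro borel_measurable_continuous_on_restrict)
        (auto simp: bregman_generator_def differentiable_imp_continuous_on)
    have \<phi>q: "(\<lambda>\<omega>. \<phi> i (q i (U \<omega>))) \<in> borel_measurable M"
      and \<phi>r: "(\<lambda>\<omega>. \<phi> i (r i (U \<omega>))) \<in> borel_measurable M"
      using q(2) r(2) unfolding random_vectors_def by (intro measurable_compose[OF _ \<phi>]; simp)+
    have g: "(\<lambda>\<omega>. gradient D (\<phi> i) (r i (U \<omega>))) \<in> borel_measurable M"
      using r(2) unfolding random_vectors_def
      by (intro measurable_compose[OF _ borel_measurable_gradient(2)[OF gens]]; simp)
    note [measurable] = \<phi>q \<phi>r g q(2)[THEN random_vectorsD(1)] r(2)[THEN random_vectorsD(1)]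
    show ?thesis unfolding bregman_divergence_def inner_real_def by measurable
  qed
  have "bw_divergence M (cart_power D) \<Phi> (joint_cdf M ?Z) (joint_cdf M X) \<le>
      (\<integral>\<^sup>+ \<omega>. ennreal (bregman_divergence (cart_power D) \<Phi> (?Z \<omega>) (?X \<omega>)) \<partial>M)"
    unfolding bw_divergence_def by (rule INF_lower2[of "(?Z, ?X)"]) (use rv cdf_X in auto)
  also have "\<dots> = (\<integral>\<^sup>+ \<omega>. (\<Sum>i\<in>UNIV. ?B i \<omega>) \<partial>M)"
  proof (rule nn_integral_cong)
    fix \<omega> assume "\<omega> \<in> space M"
    then have ZX: "?Z \<omega> \<in> cart_power D" "?X \<omega> \<in> cart_power D"
      by (rule random_vectorsD(2)[OF rv(1)], rule random_vectorsD(2)[OF rv(2)])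
    then have "0 \<le> bregman_divergence D (\<phi> i) (q i (U \<omega>)) (r i (U \<omega>))" for i
      by (intro bregman_divergence_nonneg[OF gens]) (auto simp: cart_power_def)
    then show "ennreal (bregman_divergence (cart_power D) \<Phi> (?Z \<omega>) (?X \<omega>)) = (\<Sum>i\<in>UNIV. ?B i \<omega>)"
      by (simp add: bregman_divergence_separable[OF gen gens sep ZX(2,1)] sum_ennreal)
  qed
  also have "\<dots> = (\<Sum>i\<in>UNIV. \<integral>\<^sup>+ \<omega>. ?B i \<omega> \<partial>M)"
    by (rule nn_integral_sum) (rule B_meas)
  also have "\<dots> \<le> (\<Sum>i\<in>(UNIV :: 'n set). ennreal (\<epsilon> / real CARD('n)))"
    by (intro sum_mono B)
  also have "\<dots> = ennreal \<epsilon>"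
    using \<open>0 \<le> \<epsilon>\<close> by (subst sum_ennreal) auto
  finally have "?Z \<in> bw_set M (cart_power D) \<Phi> \<epsilon> X"
    using rv by (simp add: bw_set_def)
  then show thesis using that[of U q] U(2) q by blast
qed

end

section \<open>Aggregation of risks\<close>

lemma Lp_cong:
  assumes "Y \<in> Lp M p" "\<And>\<omega>. \<omega> \<in> space M \<Longrightarrow> Y \<omega> = Y' \<omega>"
  shows "Y' \<in> Lp M p"
proof -
  have "Y' \<in> borel_measurable M"
    using assms measurable_cong[of M Y Y' borel] by (auto simp: Lp_def)
  moreover have "integrable M (\<lambda>\<omega>. \<bar>Y \<omega>\<bar> powr p) \<longleftrightarrow> integrable M (\<lambda>\<omega>. \<bar>Y' \<omega>\<bar> powr p)"
    by (rule Bochner_Integration.integrable_cong) (simp_all add: assms(2))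
  ultimately show ?thesis using assms(1) by (simp add: Lp_def)
qed

text \<open>Since |x + y| is at most twice the larger of |x| and |y|, its p-th power is at most 2^p
  times the sum of the p-th powers.\<close>

lemma Lp_add:
  assumes "0 \<le> p" and X: "X \<in> Lp M p" and Y: "Y \<in> Lp M p"
  shows "(\<lambda>\<omega>. X \<omega> + Y \<omega>) \<in> Lp M p"
proof -
  have [measurable]: "X \<in> borel_measurable M" "Y \<in> borel_measurable M"
    using X Y by (simp_all add: Lp_def)
  have bound: "\<bar>x + y\<bar> powr p \<le> 2 powr p * (\<bar>x\<bar> powr p + \<bar>y\<bar> powr p)" for x y :: real
  proof -
    have "\<bar>x + y\<bar> powr p \<le> (2 * max \<bar>x\<bar> \<bar>y\<bar>) powr p"
      by (rule powr_mono2) (use \<open>0 \<le> p\<close> in auto)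
    also have "\<dots> = 2 powr p * max \<bar>x\<bar> \<bar>y\<bar> powr p" by (simp add: powr_mult)
    also have "max \<bar>x\<bar> \<bar>y\<bar> powr p \<le> \<bar>x\<bar> powr p + \<bar>y\<bar> powr p" by (simp add: max_def)
    finally show ?thesis by simp
  qed
  have "integrable M (\<lambda>\<omega>. \<bar>X \<omega> + Y \<omega>\<bar> powr p)"
  proof (rule Bochner_Integration.integrable_bound)
    show "integrable M (\<lambda>\<omega>. 2 powr p * (\<bar>X \<omega>\<bar> powr p + \<bar>Y \<omega>\<bar> powr p))"
      using X Y by (auto simp: Lp_def)
  qed (use bound in auto)
  then show ?thesis by (simp add: Lp_def)
qed

lemma Lp_cmult:
  assumes "Y \<in> Lp M p"
  shows "(\<lambda>\<omega>. c * Y \<omega>) \<in> Lp M p"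
proof -
  have "\<bar>c * Y \<omega>\<bar> powr p = \<bar>c\<bar> powr p * \<bar>Y \<omega>\<bar> powr p" for \<omega>
    by (simp add: abs_mult powr_mult)
  with assms show ?thesis by (auto simp: Lp_def)
qed

lemma Lp_sum:
  assumes "0 \<le> p" "finite F" "F \<noteq> {}" "\<And>i. i \<in> F \<Longrightarrow> Y i \<in> Lp M p"
  shows "(\<lambda>\<omega>. \<Sum>i\<in>F. Y i \<omega>) \<in> Lp M p"
  using assms(2-4)
proof (induction rule: finite_ne_induct)
  case (insert j F)
  have "(\<lambda>\<omega>. Y j \<omega> + (\<Sum>i\<in>F. Y i \<omega>)) \<in> Lp M p"
    by (rule Lp_add[OF assms(1)]) (use insert in auto)
  with insert.hyps show ?case by simp
qed simp

text \<open>Lets \<open>g\<close> be exchanged for its separable form inside \<open>\<rho>\<close>,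
  although the two are known to agree only on the domain.\<close>

lemma law_invariant_cong:
  assumes "law_invariant M p \<rho>" "Y \<in> Lp M p" "\<And>\<omega>. \<omega> \<in> space M \<Longrightarrow> Y \<omega> = Y' \<omega>"
  shows "\<rho> Y = \<rho> Y'"
proof -
  have "distr M borel Y = distr M borel Y'" by (rule distr_cong) (simp_all add: assms(3))
  then show ?thesis using assms(1,2) Lp_cong[OF assms(2,3)] unfolding law_invariant_def by blast
qed

text \<open>The induction starts from singletons: subadditivity makes the risk of the zero function
  nonnegative, so the inequality may fail for the empty sum.\<close>

lemma subadditive_risk_sum:
  assumes sub: "subadditive_risk M p \<rho>" and "0 \<le> p"
    and "finite F" "F \<noteq> {}" "\<And>i. i \<in> F \<Longrightarrow> Y i \<in> Lp M p"
  shows "\<rho> (\<lambda>\<omega>. \<Sum>i\<in>F. Y i \<omega>) \<le> (\<Sum>i\<in>F. \<rho> (Y i))"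
  using assms(3-5)
proof (induction rule: finite_ne_induct)
  case (insert j F)
  then have "Y j \<in> Lp M p" "(\<lambda>\<omega>. \<Sum>i\<in>F. Y i \<omega>) \<in> Lp M p"
    by (auto intro!: Lp_sum[OF \<open>0 \<le> p\<close>])
  then have "\<rho> (\<lambda>\<omega>. Y j \<omega> + (\<Sum>i\<in>F. Y i \<omega>)) \<le> \<rho> (Y j) + \<rho> (\<lambda>\<omega>. \<Sum>i\<in>F. Y i \<omega>)"
    by (rule sub[unfolded subadditive_risk_def, rule_format])
  with insert show ?case by simp
qed simp

text \<open>A partial sum of monotone functions of \<open>U\<close> is again a monotone function of
  \<open>U\<close>, hence comonotonic with the next summand.\<close>

lemma (in prob_space) comonotonic_additive_sum:
  fixes U :: "'a \<Rightarrow> real"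
  assumes add: "comonotonic_additive M p \<rho>" and "0 \<le> p"
    and U: "\<And>\<omega>. \<omega> \<in> space M \<Longrightarrow> U \<omega> \<in> S"
    and "finite F" "F \<noteq> {}" "\<And>i. i \<in> F \<Longrightarrow> mono_on S (f i)"
    "\<And>i. i \<in> F \<Longrightarrow> (\<lambda>\<omega>. f i (U \<omega>)) \<in> Lp M p"
  shows "\<rho> (\<lambda>\<omega>. \<Sum>i\<in>F. f i (U \<omega>)) = (\<Sum>i\<in>F. \<rho> (\<lambda>\<omega>. f i (U \<omega>)))"
  using assms(4-7)
proof (induction rule: finite_ne_induct)
  case (insert j F)
  then have "(\<lambda>\<omega>. \<Sum>i\<in>F. f i (U \<omega>)) \<in> Lp M p" by (intro Lp_sum[OF \<open>0 \<le> p\<close>]) auto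
  moreover have "mono_on S (\<lambda>u. \<Sum>i\<in>F. f i u)"
    using insert.prems(1) by (intro mono_onI sum_mono) (meson insertI2 mono_onD)
  then have "comonotonic M (\<lambda>\<omega>. f j (U \<omega>)) (\<lambda>\<omega>. \<Sum>i\<in>F. f i (U \<omega>))"
    using insert.prems(1) by (intro comonotonic_mono_on[where S = S, OF U]) auto
  ultimately have "\<rho> (\<lambda>\<omega>. f j (U \<omega>) + (\<Sum>i\<in>F. f i (U \<omega>))) = \<rho> (\<lambda>\<omega>. f j (U \<omega>)) + \<rho> (\<lambda>\<omega>. \<Sum>i\<in>F. f i (U \<omega>))"
    using add insert.prems(2)[of j] unfolding comonotonic_additive_def by blast
  with insert show ?case by simp
qed simp

section \<open>Suprema of extended reals\<close>

text \<open>For c > 0, multiplication by c and by 1/c are monotone inverses. For c = 0 the product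
  is 0 even against an infinite supremum, and this matches the left side because the index set is
  nonempty.\<close>

lemma SUP_ereal_cmult_real:
  fixes f :: "'a \<Rightarrow> real"
  assumes "A \<noteq> {}" "0 \<le> c"
  shows "(SUP a\<in>A. ereal (c * f a)) = ereal c * (SUP a\<in>A. ereal (f a))"
proof (cases "c = 0")
  case True
  then show ?thesis using assms(1) by (simp flip: zero_ereal_def)
next
  case False
  then have c: "0 < c" using assms(2) by simp
  let ?S = "SUP a\<in>A. ereal (c * f a)"
  show ?thesis
  proof (rule antisym)
    show "?S \<le> ereal c * (SUP a\<in>A. ereal (f a))"
      using c by (intro SUP_least) (auto simp flip: times_ereal.simps(1) intro!: ereal_mult_left_mono SUP_upper)
    have "(SUP a\<in>A. ereal (f a)) \<le> ereal (1 / c) * ?S"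
    proof (rule SUP_least)
      fix a assume "a \<in> A"
      then have "ereal (1 / c) * ereal (c * f a) \<le> ereal (1 / c) * ?S"
        using c by (intro ereal_mult_left_mono SUP_upper) auto
      then show "ereal (f a) \<le> ereal (1 / c) * ?S" using c by simp
    qed
    then have "ereal c * (SUP a\<in>A. ereal (f a)) \<le> ereal c * (ereal (1 / c) * ?S)"
      using c by (intro ereal_mult_left_mono) auto
    also have "\<dots> = ?S" using c by (simp add: mult.assoc[symmetric] one_ereal_def[symmetric])
    finally show "ereal c * (SUP a\<in>A. ereal (f a)) \<le> ?S" .
  qed
qed

lemma sum_ereal_neq_MInfty:
  fixes g :: "'i \<Rightarrow> ereal"
  assumes "\<And>i. i \<in> I \<Longrightarrow> g i \<noteq> -\<infinity>"
  shows "sum g I \<noteq> -\<infinity>"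
  using assms by (induction I rule: infinite_finite_induct) (auto simp: ereal_plus_eq_MInfty)

text \<open>Choices at different indices are independent, so the suprema can be resolved one index
  at a time. The offset \<open>c\<close> collects the terms already fixed; addition moves inside a
  supremum over a nonempty set as long as the other summand is not minus infinity.\<close>

lemma sum_SUP_ereal_le:
  fixes f :: "'i \<Rightarrow> 'a \<Rightarrow> real"
  assumes "finite I" "\<And>i. i \<in> I \<Longrightarrow> A i \<noteq> {}" "c \<noteq> -\<infinity>"
    and "\<And>z. (\<And>i. i \<in> I \<Longrightarrow> z i \<in> A i) \<Longrightarrow> c + (\<Sum>i\<in>I. ereal (f i (z i))) \<le> C"
  shows "c + (\<Sum>i\<in>I. SUP a\<in>A i. ereal (f i a)) \<le> C"
  using assms
proof (induction arbitrary: c)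
  case empty
  then show ?case by simp
next
  case (insert j I)
  let ?S = "\<lambda>i. SUP a\<in>A i. ereal (f i a)"
  have "?S i \<noteq> -\<infinity>" if i: "i \<in> I" for i
  proof -
    obtain a where "a \<in> A i" using insert.prems(1)[of i] i by blast
    then have "ereal (f i a) \<le> ?S i" by (rule SUP_upper)
    then show ?thesis by auto
  qed
  then have "(\<Sum>i\<in>I. ?S i) \<noteq> -\<infinity>" by (rule sum_ereal_neq_MInfty)
  then have ne: "c + (\<Sum>i\<in>I. ?S i) \<noteq> -\<infinity>" using insert.prems(2) by (simp add: ereal_plus_eq_MInfty)
  have "c + (\<Sum>i\<in>insert j I. ?S i) = (c + (\<Sum>i\<in>I. ?S i)) + ?S j"
    using insert.hyps by (simp add: ac_simps)
  also have "\<dots> = (SUP a\<in>A j. (c + (\<Sum>i\<in>I. ?S i)) + ereal (f j a))"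
    by (rule SUP_ereal_add_right[symmetric]) (use insert.prems(1) ne in auto)
  also have "\<dots> \<le> C"
  proof (rule SUP_least)
    fix a assume a: "a \<in> A j"
    have "(c + ereal (f j a)) + (\<Sum>i\<in>I. ?S i) \<le> C"
    proof (rule insert.IH)
      show "c + ereal (f j a) \<noteq> -\<infinity>" using insert.prems(2) by (simp add: ereal_plus_eq_MInfty)
      fix z assume z: "\<And>i. i \<in> I \<Longrightarrow> z i \<in> A i"
      have "c + (\<Sum>i\<in>insert j I. ereal (f i ((z(j := a)) i))) \<le> C"
        using z a by (intro insert.prems(3)) auto
      moreover have "(\<Sum>i\<in>I. ereal (f i ((z(j := a)) i))) = (\<Sum>i\<in>I. ereal (f i (z i)))"
        using insert.hyps(2) by (intro sum.cong) auto
      ultimately show "c + ereal (f j a) + (\<Sum>i\<in>I. ereal (f i (z i))) \<le> C"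
        using insert.hyps by (simp add: ac_simps)
    qed (use insert.prems(1) in auto)
    then show "(c + (\<Sum>i\<in>I. ?S i)) + ereal (f j a) \<le> C" by (simp add: ac_simps)
  qed
  finally show ?case .
qed

section \<open>Upper and lower aggregation bounds\<close>

context separable_bregman
begin

text \<open>Common form of (i), with \<open>h\<close> equal to \<open>gi\<close>, and of the upper
  bound in (iii), where \<open>h i\<close> is multiplication by the i-th weight.\<close>

lemma SUP_risk_le_sum:
  assumes law: "law_invariant M p \<rho>" and sub: "subadditive_risk M p \<rho>" and "0 \<le> p"
    and G: "\<And>x. x \<in> cart_power D \<Longrightarrow> G x = (\<Sum>i\<in>UNIV. h i (x $ i))"
    and Lp: "\<And>i Z. Z \<in> bw_set M D (\<phi> i) \<epsilon> (\<lambda>\<omega>. X \<omega> $ i) \<Longrightarrow> (\<lambda>\<omega>. h i (Z \<omega>)) \<in> Lp M p"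
  shows "(SUP Z\<in>bw_set M (cart_power D) \<Phi> \<epsilon> X. ereal (\<rho> (\<lambda>\<omega>. G (Z \<omega>))))
    \<le> (\<Sum>i\<in>UNIV. SUP Z\<in>bw_set M D (\<phi> i) \<epsilon> (\<lambda>\<omega>. X \<omega> $ i). ereal (\<rho> (\<lambda>\<omega>. h i (Z \<omega>))))"
proof (rule SUP_least)
  fix Z assume Z: "Z \<in> bw_set M (cart_power D) \<Phi> \<epsilon> X"
  then have rv: "Z \<in> random_vectors M (cart_power D)" by (simp add: bw_set_def)
  note Zi = bw_set_component[OF Z]
  have "\<rho> (\<lambda>\<omega>. \<Sum>i\<in>UNIV. h i (Z \<omega> $ i)) = \<rho> (\<lambda>\<omega>. G (Z \<omega>))"
    by (rule law_invariant_cong[OF law])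
       (auto intro!: Lp_sum Lp Zi simp: G random_vectorsD(2)[OF rv] \<open>0 \<le> p\<close>)
  moreover have "\<rho> (\<lambda>\<omega>. \<Sum>i\<in>UNIV. h i (Z \<omega> $ i)) \<le> (\<Sum>i\<in>UNIV. \<rho> (\<lambda>\<omega>. h i (Z \<omega> $ i)))"
    by (rule subadditive_risk_sum[OF sub \<open>0 \<le> p\<close>]) (auto intro: Lp Zi)
  ultimately have "ereal (\<rho> (\<lambda>\<omega>. G (Z \<omega>))) \<le> (\<Sum>i\<in>UNIV. ereal (\<rho> (\<lambda>\<omega>. h i (Z \<omega> $ i))))"
    by simp
  also have "\<dots> \<le> (\<Sum>i\<in>UNIV. SUP Z\<in>bw_set M D (\<phi> i) \<epsilon> (\<lambda>\<omega>. X \<omega> $ i). ereal (\<rho> (\<lambda>\<omega>. h i (Z \<omega>))))"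
    by (intro sum_mono SUP_upper2[OF Zi]) simp
  finally show "ereal (\<rho> (\<lambda>\<omega>. G (Z \<omega>))) \<le> \<dots>" .
qed

text \<open>Common form of (ii) and the lower bound in (iii). Replacing each \<open>Z i\<close> by
  its quantile transform leaves its risk unchanged by law invariance, makes the summands comonotonic
  so that the risks add, and produces one element of the n-dimensional set.\<close>

lemma sum_le_SUP_risk:
  assumes law: "law_invariant M p \<rho>" and add: "comonotonic_additive M p \<rho>" and "0 \<le> p"
    and com: "comonotonic_vector M X" and "0 \<le> \<epsilon>"
    and G: "\<And>x. x \<in> cart_power D \<Longrightarrow> G x = (\<Sum>i\<in>UNIV. h i (x $ i))"
    and mono: "\<And>i. mono_on D (h i)"
    and ne: "\<And>i. bw_set M D (\<phi> i) (\<epsilon> / real CARD('n)) (\<lambda>\<omega>. X \<omega> $ i) \<noteq> {}"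
    and Lp: "\<And>i Z. Z \<in> bw_set M D (\<phi> i) (\<epsilon> / real CARD('n)) (\<lambda>\<omega>. X \<omega> $ i) \<Longrightarrow>
      (\<lambda>\<omega>. h i (Z \<omega>)) \<in> Lp M p"
  shows "(\<Sum>i\<in>UNIV. SUP Z\<in>bw_set M D (\<phi> i) (\<epsilon> / real CARD('n)) (\<lambda>\<omega>. X \<omega> $ i).
      ereal (\<rho> (\<lambda>\<omega>. h i (Z \<omega>))))
    \<le> (SUP Z\<in>bw_set M (cart_power D) \<Phi> \<epsilon> X. ereal (\<rho> (\<lambda>\<omega>. G (Z \<omega>))))"
proof -
  let ?A = "\<lambda>i. bw_set M D (\<phi> i) (\<epsilon> / real CARD('n)) (\<lambda>\<omega>. X \<omega> $ i)"
  let ?C = "SUP Z\<in>bw_set M (cart_power D) \<Phi> \<epsilon> X. ereal (\<rho> (\<lambda>\<omega>. G (Z \<omega>)))"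
  have "0 + (\<Sum>i\<in>UNIV. ereal (\<rho> (\<lambda>\<omega>. h i (Z i \<omega>)))) \<le> ?C" if Z: "\<And>i. Z i \<in> ?A i" for Z
  proof -
    obtain U :: "'w \<Rightarrow> real" and q where U: "\<And>\<omega>. U \<omega> \<in> {0<..<1}"
      and q: "\<And>i. mono_on {0<..<1} (q i)" "\<And>i. (\<lambda>\<omega>. q i (U \<omega>)) \<in> random_vectors M D"
        "\<And>i. joint_cdf M (\<lambda>\<omega>. q i (U \<omega>)) = joint_cdf M (Z i)"
        "(\<lambda>\<omega>. \<chi> i. q i (U \<omega>)) \<in> bw_set M (cart_power D) \<Phi> \<epsilon> X"
      using bw_set_comonotonic_rearrangement[OF com \<open>0 \<le> \<epsilon>\<close> Z] by metis
    have Zrv: "Z i \<in> random_vectors M D" for i using Z[of i] by (simp add: bw_set_def)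
    have "(\<lambda>\<omega>. q i (U \<omega>)) \<in> ?A i" for i
      using Z[of i] q(2,3)[of i] by (simp add: bw_set_def)
    then have qLp: "(\<lambda>\<omega>. h i (q i (U \<omega>))) \<in> Lp M p" for i by (rule Lp)
    have "\<rho> (\<lambda>\<omega>. h i (q i (U \<omega>))) = \<rho> (\<lambda>\<omega>. h i (Z i \<omega>))" for i
    proof -
      have "distr M borel (\<lambda>\<omega>. q i (U \<omega>)) = distr M borel (Z i)"
        by (intro distr_eqI_joint_cdf random_vectorsD(1)[OF q(2)] random_vectorsD(1)[OF Zrv] q(3))
      \<comment> \<open>Equality of laws transfers along Borel functions on the whole line, so
        \<open>h i\<close>, monotone on \<open>D\<close> only, is extended by 0.\<close>
      define h' where "h' x = (if x \<in> D then h i x else 0)" for x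
      have [measurable]: "h' \<in> borel_measurable borel"
        unfolding h'_def using borel_measurable_mono_on_fnc[OF mono[of i]] borel_measurable_gradient(1)[OF gens]
        by (subst measurable_restrict_space_iff[symmetric]) auto
      have "distr M borel (\<lambda>\<omega>. h' (q i (U \<omega>))) = distr M borel (\<lambda>\<omega>. h' (Z i \<omega>))"
        by (rule distr_eq_compose[where N = borel])
           (use random_vectorsD(1)[OF q(2)] random_vectorsD(1)[OF Zrv] \<open>distr M borel (\<lambda>\<omega>. q i (U \<omega>)) = _\<close> in auto)
      moreover have "distr M borel (\<lambda>\<omega>. h' (q i (U \<omega>))) = distr M borel (\<lambda>\<omega>. h i (q i (U \<omega>)))"
        by (rule distr_cong) (use random_vectorsD(2)[OF q(2)] in \<open>auto simp: h'_def\<close>)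
      moreover have "distr M borel (\<lambda>\<omega>. h' (Z i \<omega>)) = distr M borel (\<lambda>\<omega>. h i (Z i \<omega>))"
        by (rule distr_cong) (use random_vectorsD(2)[OF Zrv] in \<open>auto simp: h'_def\<close>)
      ultimately show ?thesis
        by (intro law[unfolded law_invariant_def, rule_format] qLp Lp[OF Z]) simp
    qed
    then have "(\<Sum>i\<in>UNIV. \<rho> (\<lambda>\<omega>. h i (Z i \<omega>))) = (\<Sum>i\<in>UNIV. \<rho> (\<lambda>\<omega>. h i (q i (U \<omega>))))"
      by simp
    also have "\<dots> = \<rho> (\<lambda>\<omega>. \<Sum>i\<in>UNIV. h i (q i (U \<omega>)))"
    proof -
      \<comment> \<open>That \<open>q i u\<close> lies in \<open>D\<close> is available only at
        values attained by \<open>U\<close>, so monotonicity of the composition is claimed on this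
        range.\<close>
      let ?S = "U ` space M"
      have "mono_on ?S (\<lambda>u. h i (q i u))" for i
      proof (rule mono_onI)
        fix u v assume uv: "u \<in> ?S" "v \<in> ?S" "u \<le> v"
        then have "q i u \<le> q i v" using U by (intro mono_onD[OF q(1)]) auto
        moreover have "q i u \<in> D" "q i v \<in> D" using uv random_vectorsD(2)[OF q(2)] by auto
        ultimately show "h i (q i u) \<le> h i (q i v)" by (intro mono_onD[OF mono])
      qed
      then show ?thesis
        by (intro comonotonic_additive_sum[OF add \<open>0 \<le> p\<close>, where S = ?S, symmetric] qLp) auto
    qed
    also have "\<dots> = \<rho> (\<lambda>\<omega>. G (\<chi> i. q i (U \<omega>)))"
    proof (rule law_invariant_cong[OF law])
      show "(\<lambda>\<omega>. \<Sum>i\<in>UNIV. h i (q i (U \<omega>))) \<in> Lp M p"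
        by (intro Lp_sum qLp \<open>0 \<le> p\<close>) auto
      fix \<omega> assume "\<omega> \<in> space M"
      then have "(\<chi> i. q i (U \<omega>)) \<in> cart_power D"
        using random_vectorsD(2)[OF q(2)] by (simp add: cart_power_def)
      then show "(\<Sum>i\<in>UNIV. h i (q i (U \<omega>))) = G (\<chi> i. q i (U \<omega>))" by (simp add: G)
    qed
    finally show ?thesis using SUP_upper[OF q(4), of "\<lambda>Z. ereal (\<rho> (\<lambda>\<omega>. G (Z \<omega>)))"] by simp
  qed
  then have "0 + (\<Sum>i\<in>UNIV. SUP Z\<in>?A i. ereal (\<rho> (\<lambda>\<omega>. h i (Z \<omega>)))) \<le> ?C"
    by (intro sum_SUP_ereal_le[where f = "\<lambda>i Z. \<rho> (\<lambda>\<omega>. h i (Z \<omega>))"]) (simp_all add: ne)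
  then show ?thesis by simp
qed

end

section \<open>Assembly of the three inequalities\<close>

lemma bw_set_mono:
  assumes "\<epsilon> \<le> \<epsilon>'"
  shows "bw_set M S \<Phi> \<epsilon> X \<subseteq> bw_set M S \<Phi> \<epsilon>' X"
  using ennreal_leI[OF assms] by (auto simp: bw_set_def intro: order_trans)

theorem proposition4:
  fixes M :: "'w measure"
    and D :: "real set"
    and X :: "'w \<Rightarrow> real ^ 'n"
    and \<Phi> :: "real ^ 'n \<Rightarrow> real" and \<phi> :: "'n \<Rightarrow> real \<Rightarrow> real"
    and g :: "real ^ 'n \<Rightarrow> real" and gi :: "'n \<Rightarrow> real \<Rightarrow> real"
    and \<rho> :: "('w \<Rightarrow> real) \<Rightarrow> real"
    and p \<epsilon> :: real
  assumes "prob_space M" and "nonatomic M"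
    and "X \<in> random_vectors M (cart_power D)"
    and "bregman_generator (cart_power D) \<Phi>"
    and "\<And>i. bregman_generator D (\<phi> i)"
    and "\<And>x. x \<in> cart_power D \<Longrightarrow> \<Phi> x = (\<Sum>i\<in>UNIV. \<phi> i (x $ i))"
    and "\<And>x. x \<in> cart_power D \<Longrightarrow> g x = (\<Sum>i\<in>UNIV. gi i (x $ i))"
    and "\<not> g constant_on cart_power D"
    and "1 \<le> p" and "law_invariant M p \<rho>"
    and "0 \<le> \<epsilon>"
    and "at_least_two M (bw_set M (cart_power D) \<Phi> \<epsilon> X)"
    and "\<And>i. at_least_two M (bw_set M D (\<phi> i) \<epsilon> (\<lambda>\<omega>. X \<omega> $ i))"
    and "\<And>i. at_least_two M (bw_set M D (\<phi> i) (\<epsilon> / real CARD('n)) (\<lambda>\<omega>. X \<omega> $ i))"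
  shows
    "(subadditive_risk M p \<rho> \<and>
      (\<forall>i. \<forall>Z\<in>bw_set M D (\<phi> i) \<epsilon> (\<lambda>\<omega>. X \<omega> $ i). (\<lambda>\<omega>. gi i (Z \<omega>)) \<in> Lp M p)
      \<longrightarrow>
      (SUP Z\<in>bw_set M (cart_power D) \<Phi> \<epsilon> X. ereal (\<rho> (\<lambda>\<omega>. g (Z \<omega>))))
        \<le> (\<Sum>i\<in>UNIV. SUP Z\<in>bw_set M D (\<phi> i) \<epsilon> (\<lambda>\<omega>. X \<omega> $ i). ereal (\<rho> (\<lambda>\<omega>. gi i (Z \<omega>)))))
     \<and>
     (comonotonic_vector M X \<and> comonotonic_additive M p \<rho> \<and> (\<forall>i. mono_on D (gi i)) \<and>
      (\<forall>i. \<forall>Z\<in>bw_set M D (\<phi> i) (\<epsilon> / real CARD('n)) (\<lambda>\<omega>. X \<omega> $ i).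
         (\<lambda>\<omega>. gi i (Z \<omega>)) \<in> Lp M p) \<and>
      (\<forall>Z\<in>bw_set M (cart_power D) \<Phi> \<epsilon> X. (\<lambda>\<omega>. g (Z \<omega>)) \<in> Lp M p)
      \<longrightarrow>
      (\<Sum>i\<in>UNIV. SUP Z\<in>bw_set M D (\<phi> i) (\<epsilon> / real CARD('n)) (\<lambda>\<omega>. X \<omega> $ i).
         ereal (\<rho> (\<lambda>\<omega>. gi i (Z \<omega>))))
        \<le> (SUP Z\<in>bw_set M (cart_power D) \<Phi> \<epsilon> X. ereal (\<rho> (\<lambda>\<omega>. g (Z \<omega>)))))
     \<and>
     (\<forall>\<beta>.
      comonotonic_vector M X \<and> (\<forall>i. 0 \<le> \<beta> $ i) \<and> (\<forall>x\<in>cart_power D. g x = \<beta> \<bullet> x) \<and>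
      positive_homogeneous M p \<rho> \<and> subadditive_risk M p \<rho> \<and> comonotonic_additive M p \<rho> \<and>
      (\<forall>i. \<forall>Z\<in>bw_set M D (\<phi> i) \<epsilon> (\<lambda>\<omega>. X \<omega> $ i). Z \<in> Lp M p)
      \<longrightarrow>
      (\<Sum>i\<in>UNIV. ereal (\<beta> $ i) *
         (SUP Z\<in>bw_set M D (\<phi> i) (\<epsilon> / real CARD('n)) (\<lambda>\<omega>. X \<omega> $ i). ereal (\<rho> Z)))
        \<le> (SUP Z\<in>bw_set M (cart_power D) \<Phi> \<epsilon> X. ereal (\<rho> (\<lambda>\<omega>. \<beta> \<bullet> Z \<omega>)))
      \<and>
      (SUP Z\<in>bw_set M (cart_power D) \<Phi> \<epsilon> X. ereal (\<rho> (\<lambda>\<omega>. \<beta> \<bullet> Z \<omega>)))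
        \<le> (\<Sum>i\<in>UNIV. ereal (\<beta> $ i) *
             (SUP Z\<in>bw_set M D (\<phi> i) \<epsilon> (\<lambda>\<omega>. X \<omega> $ i). ereal (\<rho> Z))))"
proof -
  interpret separable_bregman M D \<Phi> \<phi> X
    by (intro separable_bregman.intro separable_bregman_axioms.intro assms(1-6))
  have p: "0 \<le> p" using assms(9) by simp
  note law = assms(10) and eps = assms(11)
  let ?A = "\<lambda>\<epsilon> i. bw_set M D (\<phi> i) \<epsilon> (\<lambda>\<omega>. X \<omega> $ i)"
  let ?n = "real CARD('n)"
  have ne: "?A \<epsilon> i \<noteq> {}" "?A (\<epsilon> / ?n) i \<noteq> {}" for i
    using assms(13,14)[of i] by (auto simp: at_least_two_def)
  have "1 \<le> ?n" by (simp add: Suc_leI)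
  then have "\<epsilon> / ?n \<le> \<epsilon>" using divide_left_mono[of 1 ?n \<epsilon>] eps by simp
  \<comment> \<open>In (iii) integrability is assumed for the sets of radius \<epsilon>; this
    inclusion carries it over to radius \<epsilon>/n.\<close>
  then have sub: "Z \<in> ?A \<epsilon> i" if "Z \<in> ?A (\<epsilon> / ?n) i" for Z i
    using subsetD[OF bw_set_mono that] by blast
  show ?thesis
  \<comment> \<open>Cases 1 and 2 are (i) and (ii); cases 3 and 4 are the lower and the upper bound
    of (iii).\<close>
  proof (intro conjI impI allI, goal_cases)
    case 1
    then show ?case by (intro SUP_risk_le_sum[where G = g and h = gi, OF law _ p assms(7)]) auto
  next
    case 2
    then show ?case by (intro sum_le_SUP_risk[where G = g and h = gi, OF law _ p _ eps assms(7) _ ne(2)]) auto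
  next
    case (3 \<beta>)
    have "(\<Sum>i\<in>UNIV. SUP Z\<in>?A (\<epsilon> / ?n) i. ereal (\<rho> (\<lambda>\<omega>. \<beta> $ i * Z \<omega>)))
        \<le> (SUP Z\<in>bw_set M (cart_power D) \<Phi> \<epsilon> X. ereal (\<rho> (\<lambda>\<omega>. \<beta> \<bullet> Z \<omega>)))"
      using 3 by (intro sum_le_SUP_risk[where G = "\<lambda>x. \<beta> \<bullet> x" and h = "\<lambda>i x. \<beta> $ i * x",
            OF law _ p _ eps _ _ ne(2)])
        (auto intro!: Lp_cmult sub mono_onI mult_left_mono simp: inner_vec_def)
    \<comment> \<open>Positive homogeneity takes the weight out of each risk, and nonemptiness of
      the set then takes it out of the supremum, also for weight 0.\<close>
    moreover have "(SUP Z\<in>?A (\<epsilon> / ?n) i. ereal (\<rho> (\<lambda>\<omega>. \<beta> $ i * Z \<omega>)))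
        = ereal (\<beta> $ i) * (SUP Z\<in>?A (\<epsilon> / ?n) i. ereal (\<rho> Z))" for i
    proof -
      have "\<rho> (\<lambda>\<omega>. \<beta> $ i * Z \<omega>) = \<beta> $ i * \<rho> Z" if "Z \<in> ?A (\<epsilon> / ?n) i" for Z
        using 3 sub[OF that] unfolding positive_homogeneous_def by blast
      then show ?thesis using 3 by (subst SUP_ereal_cmult_real[OF ne(2), symmetric]) auto
    qed
    ultimately show ?case by simp
  next
    case (4 \<beta>)
    have "(SUP Z\<in>bw_set M (cart_power D) \<Phi> \<epsilon> X. ereal (\<rho> (\<lambda>\<omega>. \<beta> \<bullet> Z \<omega>)))
        \<le> (\<Sum>i\<in>UNIV. SUP Z\<in>?A \<epsilon> i. ereal (\<rho> (\<lambda>\<omega>. \<beta> $ i * Z \<omega>)))"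
      using 4 by (intro SUP_risk_le_sum[where G = "\<lambda>x. \<beta> \<bullet> x" and h = "\<lambda>i x. \<beta> $ i * x",
            OF law _ p])
        (auto intro!: Lp_cmult simp: inner_vec_def)
    moreover have "(SUP Z\<in>?A \<epsilon> i. ereal (\<rho> (\<lambda>\<omega>. \<beta> $ i * Z \<omega>)))
        = ereal (\<beta> $ i) * (SUP Z\<in>?A \<epsilon> i. ereal (\<rho> Z))" for i
    proof -
      have "\<rho> (\<lambda>\<omega>. \<beta> $ i * Z \<omega>) = \<beta> $ i * \<rho> Z" if "Z \<in> ?A \<epsilon> i" for Z
        using 4 that unfolding positive_homogeneous_def by blast
      then show ?thesis using 4 by (subst SUP_ereal_cmult_real[OF ne(1), symmetric]) auto
    qed
    ultimately show ?case by simp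
  qed
qed

end
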